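(* Let $\mathcal G$ be a finite connected graph with Kirchhoff conditions at interior vertices and a fixed Dirichlet or Neumann condition at each exterior vertex, let $\ell\in(0,\infty)^{\mathcal E}$, let $K\subsetneq\mathcal G$ be a proper primitive subgraph, and let $\theta^\star\in H_\ell\cap\mathcal R_K$. Put $r_\ell=\dim H_\ell$. If $r_\ell\ge2$ and the intrinsic flow of $\ell$ is $(\gamma,\tau)$-Diophantine for some $\gamma>0$, $\tau>r_\ell-1$, then there are a constant $C>0$ and $k_n\to\infty$ such that $\theta_n=[k_n\ell]\in Z_B$ and $$\operatorname{dist}_{H_\ell}(\theta_n,\theta^\star)\le C\,k_n^{-1/\tau}\qquad\text{for all }n.$$ If $r_\ell=1$, the flow $t\mapsto\theta+t\ell$ on $H_\ell$ is periodic, and there exist $k_n\to\infty$ with $[k_n\ell]=\theta^\star$ for all $n$.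
   Context: $\mathcal G$ is a finite connected graph with edge set $\mathcal E$ (loops and parallel edges allowed); a vertex is exterior if it has degree one (loops count twice), interior otherwise. A primitive subgraph is a simple cycle (a loop is a one-edge simple cycle; two parallel edges may form a two-edge simple cycle) or a simple path joining two exterior vertices; it is proper if it is not all of $\mathcal G$. $\mathbb T=\mathbb R/2\pi\mathbb Z$. Let $\mathcal B$ be the set of directed bonds (each edge $e$ gives two, $(e,+)$ and $(e,-)$, reverses of each other). Let $S_B$ be the unitary matrix on $\mathbb C^{\mathcal B}$ with $(S_Ba)_b=\sum_{b'}\sigma_{bb'}a_{b'}$, the sum over bonds $b'$ ending at the initial vertex $v$ of $b$; if $v$ is interior of degree $d$, $\sigma_{bb'}=2/d-1$ if $b'$ is the reverse of $b$ and $2/d$ otherwise; if $v$ is exterior, $\sigma_{bb'}=-1$ (Dirichlet) or $+1$ (Neumann). For $\theta\in\mathbb T^{\mathcal E}$, $D(\theta)$ is the diagonal matrix with entry $e^{i\theta_e}$ on both bonds of $e$, $U_B(\theta)=D(\theta)S_B$, $I_e(a)=|a_{e,+}|^2+|a_{e,-}|^2$, and $Z_B=\{\theta:\det(I-U_B(\theta))=0\}$. $\mathcal R_K\subset Z_B$ is the set of $\theta$ for which $1$ is a simple eigenvalue of $U_B(\theta)$ and its eigenvector $a$ is supported exactly on $K$ ($I_e(a)>0$ iff $e\subset K$). $H_\ell=\overline{\{[k\ell]:k\in\mathbb R\}}\subset\mathbb T^{\mathcal E}$, a subtorus of dimension $r_\ell$; $\operatorname{dist}_{H_\ell}$ is the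 distance of a fixed flat metric on it. Choose a Lie-group isomorphism $\Xi:\mathbb T^{r_\ell}\to H_\ell$ induced by integral lattice coordinates and $\beta\in\mathbb R^{r_\ell}$ with $\Xi([t\beta])=[t\ell]$ for all $t$. With $\widehat\beta=\beta/\|\beta\|$, for $r_\ell\ge2$ the intrinsic flow is $(\gamma,\tau)$-Diophantine if $|q\cdot\widehat\beta|\ge\gamma\|q\|^{-\tau}$ for every $q\in\mathbb Z^{r_\ell}\setminus\{0\}$, where $\tau>r_\ell-1$. *)

theory Defs
  imports "HOL-Analysis.Analysis" "HOL-Computational_Algebra.Polynomial"
begin

section \<open>Multigraphs and primitive subgraphs\<close>

text \<open>A finite multigraph, loops and parallel edges allowed: the vertex and edge sets are finite
  types, and each edge is mapped to its two endpoints. The order of the endpoints is an arbitrary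
  reference orientation. The directed bond \<open>(e, True)\<close>, i.e. \<open>(e,+)\<close>, runs from the first endpoint
  to the second one, and \<open>(e, False)\<close>, i.e. \<open>(e,-)\<close>, is its reverse.\<close>

type_synonym ('v, 'e) multigraph = "'e \<Rightarrow> 'v \<times> 'v"

type_synonym 'e bond = "'e \<times> bool"

definition bond_init :: "('v, 'e) multigraph \<Rightarrow> 'e bond \<Rightarrow> 'v" where
  "bond_init G b = (if snd b then fst (G (fst b)) else snd (G (fst b)))"

definition bond_rev :: "'e bond \<Rightarrow> 'e bond" where
  "bond_rev b = (fst b, \<not> snd b)"

definition bond_term :: "('v, 'e) multigraph \<Rightarrow> 'e bond \<Rightarrow> 'v" where
  "bond_term G b = bond_init G (bond_rev b)"

text \<open>Counting the bonds that start at a vertex counts every loop there twice.\<close>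

definition vdegree :: "('v, 'e) multigraph \<Rightarrow> 'v \<Rightarrow> nat" where
  "vdegree G v = card {b. bond_init G b = v}"

definition exterior :: "('v, 'e) multigraph \<Rightarrow> 'v \<Rightarrow> bool" where
  "exterior G v \<longleftrightarrow> vdegree G v = 1"

definition connected_graph :: "('v, 'e) multigraph \<Rightarrow> bool" where
  "connected_graph G \<longleftrightarrow> (\<forall>u v. (u, v) \<in> (range (\<lambda>b. (bond_init G b, bond_term G b)))\<^sup>*)"

definition bond_walk :: "('v, 'e) multigraph \<Rightarrow> 'e bond list \<Rightarrow> bool" where
  "bond_walk G bs \<longleftrightarrow> bs \<noteq> [] \<and>
     (\<forall>i. Suc i < length bs \<longrightarrow> bond_term G (bs ! i) = bond_init G (bs ! Suc i))"

text \<open>Distinctness of the edges in a simple cycle only excludes traversing a single edge back and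
  forth. A loop gives a cycle of length one, two parallel edges give a cycle of length two.\<close>

definition simple_cycle :: "('v, 'e) multigraph \<Rightarrow> 'e bond list \<Rightarrow> bool" where
  "simple_cycle G bs \<longleftrightarrow> bond_walk G bs \<and> bond_term G (last bs) = bond_init G (hd bs) \<and>
     distinct (map (bond_init G) bs) \<and> distinct (map fst bs)"

definition simple_exterior_path :: "('v, 'e) multigraph \<Rightarrow> 'e bond list \<Rightarrow> bool" where
  "simple_exterior_path G bs \<longleftrightarrow> bond_walk G bs \<and>
     distinct (map (bond_init G) bs @ [bond_term G (last bs)]) \<and>
     exterior G (bond_init G (hd bs)) \<and> exterior G (bond_term G (last bs))"

text \<open>Cycles and paths of positive length have no isolated vertices, and neither does a connected
  graph with at least one edge. Such subgraphs are therefore determined by their edge sets, and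
  being all of the graph means containing all edges.\<close>

definition primitive_subgraph :: "('v, 'e) multigraph \<Rightarrow> 'e set \<Rightarrow> bool" where
  "primitive_subgraph G K \<longleftrightarrow>
     (\<exists>bs. (simple_cycle G bs \<or> simple_exterior_path G bs) \<and> K = fst ` set bs)"

definition proper_primitive_subgraph :: "('v, 'e) multigraph \<Rightarrow> 'e set \<Rightarrow> bool" where
  "proper_primitive_subgraph G K \<longleftrightarrow> primitive_subgraph G K \<and> K \<noteq> UNIV"


section \<open>The torus, orbit closures and flat metrics\<close>

text \<open>\<open>\<real>/2\<pi>\<int>\<close> is identified with the unit circle by \<open>t \<mapsto> e\<^bsup>it\<^esup>\<close>. A point \<open>\<theta>\<close> of the torus is thus
  stored as the vector of the numbers \<open>e\<^bsup>i\<theta>\<^sub>j\<^esup>\<close>, the group operation is the componentwise product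
  \<open>*\<close>, and the topology is that of the ambient space.\<close>

definition torus :: "(complex ^ 'n) set" where
  "torus = {z. \<forall>j. cmod (z $ j) = 1}"

definition tclass :: "real ^ 'n \<Rightarrow> complex ^ 'n" where
  "tclass x = (\<chi> j. cis (x $ j))"

definition orbit_closure :: "real ^ 'n \<Rightarrow> (complex ^ 'n) set" where
  "orbit_closure l = closure (range (\<lambda>k::real. tclass (k *\<^sub>R l)))"

text \<open>The Lie algebra of a closed subgroup \<open>H\<close> of the torus, as a subspace of \<open>\<real>\<^sup>n\<close>.\<close>

definition torus_lie_algebra :: "(complex ^ 'n) set \<Rightarrow> (real ^ 'n) set" where
  "torus_lie_algebra H = {v. \<forall>t::real. tclass (t *\<^sub>R v) \<in> H}"

definition torus_dim :: "(complex ^ 'n) set \<Rightarrow> nat" where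
  "torus_dim H = dim (torus_lie_algebra H)"

definition pos_def_form :: "(real ^ 'n \<Rightarrow> real ^ 'n \<Rightarrow> real) \<Rightarrow> bool" where
  "pos_def_form B \<longleftrightarrow> bilinear B \<and> (\<forall>x y. B x y = B y x) \<and> (\<forall>x. x \<noteq> 0 \<longrightarrow> 0 < B x x)"

text \<open>A flat (translation-invariant) Riemannian metric on a subtorus \<open>H\<close> is given by an inner
  product on its Lie algebra, and every such inner product is the restriction of a positive definite
  form \<open>B\<close> on \<open>\<real>\<^sup>n\<close>. The geodesics are the translates of one-parameter subgroups, so the
  distance of \<open>x\<close> and \<open>y\<close> is the least length of a tangent vector \<open>v\<close> with \<open>x + [v] = y\<close>.\<close>

definition flat_dist ::
    "(real ^ 'n \<Rightarrow> real ^ 'n \<Rightarrow> real) \<Rightarrow> (complex ^ 'n) set \<Rightarrow> complex ^ 'n \<Rightarrow> complex ^ 'n \<Rightarrow> real"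
  where
  "flat_dist B H x y = Inf {sqrt (B v v) |v. v \<in> torus_lie_algebra H \<and> x * tclass v = y}"

text \<open>A bijection onto \<open>H\<close> induced by an integral matrix is automatically a homomorphism and a
  homeomorphism, hence an isomorphism of Lie groups.\<close>

definition torus_lie_iso :: "(complex ^ 'r \<Rightarrow> complex ^ 'n) \<Rightarrow> (complex ^ 'n) set \<Rightarrow> bool" where
  "torus_lie_iso \<Xi> H \<longleftrightarrow> bij_betw \<Xi> torus H \<and>
     (\<exists>A :: int ^ 'r ^ 'n. \<forall>x. \<Xi> (tclass x) = tclass (map_matrix real_of_int A *v x))"

definition diophantine :: "real ^ 'r \<Rightarrow> real \<Rightarrow> real \<Rightarrow> bool" where
  "diophantine \<beta> \<gamma> \<tau> \<longleftrightarrow>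
     (\<forall>q :: real ^ 'r. (\<forall>j. q $ j \<in> \<int>) \<and> q \<noteq> 0 \<longrightarrow>
        \<bar>q \<bullet> (\<beta> /\<^sub>R norm \<beta>)\<bar> \<ge> \<gamma> * norm q powr (- \<tau>))"


section \<open>The bond scattering matrix and the secular set\<close>

datatype boundary_cond = Dirichlet | Neumann

definition scattering ::
    "('v, 'e) multigraph \<Rightarrow> ('v \<Rightarrow> boundary_cond) \<Rightarrow> 'e bond \<Rightarrow> 'e bond \<Rightarrow> complex" where
  "scattering G bc b b' =
     (let v = bond_init G b; d = of_nat (vdegree G v) in
      if exterior G v then (case bc v of Dirichlet \<Rightarrow> -1 | Neumann \<Rightarrow> 1)
      else if b' = bond_rev b then 2 / d - 1 else 2 / d)"

definition S_B ::
    "('v, 'e::finite) multigraph \<Rightarrow> ('v \<Rightarrow> boundary_cond) \<Rightarrow> complex ^ 'e bond ^ 'e bond" where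
  "S_B G bc = (\<chi> b b'. if bond_term G b' = bond_init G b then scattering G bc b b' else 0)"

text \<open>The entry of a torus point at \<open>e\<close> already is \<open>e\<^bsup>i\<theta>\<^sub>e\<^esup>\<close>.\<close>

definition D_B :: "complex ^ 'e \<Rightarrow> complex ^ ('e::finite) bond ^ 'e bond" where
  "D_B \<theta> = (\<chi> b b'. if b = b' then \<theta> $ fst b else 0)"

definition U_B :: "('v, 'e::finite) multigraph \<Rightarrow> ('v \<Rightarrow> boundary_cond) \<Rightarrow> complex ^ 'e
    \<Rightarrow> complex ^ 'e bond ^ 'e bond" where
  "U_B G bc \<theta> = D_B \<theta> ** S_B G bc"

definition Z_B :: "('v, 'e::finite) multigraph \<Rightarrow> ('v \<Rightarrow> boundary_cond) \<Rightarrow> (complex ^ 'e) set" where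
  "Z_B G bc = {\<theta> \<in> torus. det (mat 1 - U_B G bc \<theta>) = 0}"

definition edge_intensity :: "complex ^ ('e::finite) bond \<Rightarrow> 'e \<Rightarrow> real" where
  "edge_intensity a e = (cmod (a $ (e, True)))\<^sup>2 + (cmod (a $ (e, False)))\<^sup>2"

definition charpoly :: "complex ^ 'n ^ 'n \<Rightarrow> complex poly" where
  "charpoly A = det (\<chi> i j. (if i = j then [:0, 1:] else 0) - [:A $ i $ j:])"

definition simple_eigenvalue :: "complex ^ 'n ^ 'n \<Rightarrow> complex \<Rightarrow> bool" where
  "simple_eigenvalue A c \<longleftrightarrow> order c (charpoly A) = 1"

text \<open>A simple eigenvalue determines its eigenvector up to a nonzero factor, which does not affect
  the support.\<close>

definition R_set ::
    "('v, 'e::finite) multigraph \<Rightarrow> ('v \<Rightarrow> boundary_cond) \<Rightarrow> 'e set \<Rightarrow> (complex ^ 'e) set" where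
  "R_set G bc K = {\<theta> \<in> Z_B G bc. simple_eigenvalue (U_B G bc \<theta>) 1 \<and>
     (\<exists>a. a \<noteq> 0 \<and> U_B G bc \<theta> *v a = a \<and> (\<forall>e. edge_intensity a e > 0 \<longleftrightarrow> e \<in> K))}"

end

(* Along the flow the secular determinant, multiplied by a suitable phase, is a real function. At a
   point where 1 is a simple eigenvalue of U, its derivative along the flow is nonzero because all
   edge lengths are positive. Hence an orbit passing within eps of theta* meets the secular set
   after a further time O(eps). It remains to make the orbit pass close to theta*. A Diophantine
   flow comes 1/m-close to every point of the torus within any time window of length O(m^tau): the
   frequencies of a trigonometric polynomial of degree m are separated along the flow by at least a
   constant times m^(-tau), so Ingham's inequality compares its mean square over such a window with
   its L^2 norm. A one-dimensional orbit closure is a closed orbit. *)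
theory Submission
  imports Defs
begin

section \<open>Ingham's inequality\<close>

text \<open>Kronecker density gives no rate. The exponent comes from the spectral gap: a window of
  length proportional to m^tau yields a distance of order 1/m, and eliminating m gives k^(-1/tau).
  For this to be a bound in terms of the hitting time k itself, k must be at most a constant times
  m^tau, and for k to tend to infinity it must not be small either. The approach is therefore sought
  in a window that starts at a time equal to its own length, by aiming at a target translated
  backwards along the flow. Mean squares are weighted by the parabola t (L - t) instead of a sharp
  cutoff: the cross terms then decay like the inverse square of the frequency difference, which is
  summable over separated frequencies. The phase has to be removed because the zero is found by the
  intermediate value theorem, which needs a real function. The approximate approach becomes an exact
  zero by a change of time only, so the point stays on the orbit.\<close>

lemma sum_inverse_squares_le: "(\<Sum>j=1..N. 1 / (real j)\<^sup>2) \<le> 2"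
proof -
  \<comment> \<open>The subtracted term makes the induction close: the next summand is absorbed by
    telescoping.\<close>
  have "(\<Sum>j=1..Suc N. 1 / (real j)\<^sup>2) \<le> 2 - 1 / real (Suc N)" for N
  proof (induction N)
    case (Suc N)
    have "1 / (real (Suc (Suc N)))\<^sup>2 \<le> 1 / real (Suc N) - 1 / real (Suc (Suc N))"
    proof -
      have "1 / (real (Suc (Suc N)))\<^sup>2 \<le> 1 / (real (Suc N) * real (Suc (Suc N)))"
        by (intro frac_le) (auto simp: power2_eq_square)
      also have "\<dots> = 1 / real (Suc N) - 1 / real (Suc (Suc N))" by (simp add: field_simps)
      finally show ?thesis .
    qed
    with Suc show ?case by simp
  qed simp
  from this[of N] have "(\<Sum>j=1..Suc N. 1 / (real j)\<^sup>2) \<le> 2"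
    by (rule order_trans) simp
  moreover have "(\<Sum>j=1..N. 1 / (real j)\<^sup>2) \<le> (\<Sum>j=1..Suc N. 1 / (real j)\<^sup>2)"
    by simp
  ultimately show ?thesis by linarith
qed

text \<open>The cell numbers floor (x / \<delta>) are positive and, by separation, pairwise
  distinct. Each x is at least \<delta> times its number, so the inverse squares of the integers
  dominate.\<close>

lemma sum_inverse_squares_separated_pos:
  fixes X :: "real set"
  assumes "finite X" "0 < \<delta>" and ge: "\<And>x. x \<in> X \<Longrightarrow> \<delta> \<le> x"
    and sep: "\<And>x y. x \<in> X \<Longrightarrow> y \<in> X \<Longrightarrow> x \<noteq> y \<Longrightarrow> \<delta> \<le> \<bar>x - y\<bar>"
  shows "(\<Sum>x\<in>X. 1 / x\<^sup>2) \<le> 2 / \<delta>\<^sup>2"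
proof -
  define j where "j x = nat \<lfloor>x / \<delta>\<rfloor>" for x
  have j: "1 \<le> j x" "real (j x) \<le> x / \<delta>" if "x \<in> X" for x
  proof -
    have "1 \<le> x / \<delta>" using ge[OF that] \<open>0 < \<delta>\<close> by (simp add: field_simps)
    then show "1 \<le> j x" "real (j x) \<le> x / \<delta>" unfolding j_def by linarith+
  qed
  have inj: "inj_on j X"
  proof (rule inj_onI, rule ccontr)
    fix x y assume xy: "x \<in> X" "y \<in> X" "j x = j y" "x \<noteq> y"
    then have "\<lfloor>x / \<delta>\<rfloor> = \<lfloor>y / \<delta>\<rfloor>" using j(1) unfolding j_def by (metis eq_nat_nat_iff linorder_le_cases nat_0_iff not_one_le_zero)
    then have "\<bar>x / \<delta> - y / \<delta>\<bar> < 1" by linarith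
    then have "\<bar>x - y\<bar> / \<delta> < 1" using \<open>0 < \<delta>\<close> by (simp add: diff_divide_distrib[symmetric])
    with sep[OF xy(1,2,4)] \<open>0 < \<delta>\<close> show False by (simp add: field_simps)
  qed
  have "(\<Sum>x\<in>X. 1 / x\<^sup>2) \<le> (\<Sum>x\<in>X. (1 / (real (j x))\<^sup>2) / \<delta>\<^sup>2)"
  proof (rule sum_mono)
    fix x assume x: "x \<in> X"
    have "real (j x) * \<delta> \<le> x" using j(2)[OF x] \<open>0 < \<delta>\<close> by (simp add: field_simps)
    then have "(real (j x) * \<delta>)\<^sup>2 \<le> x\<^sup>2" using \<open>0 < \<delta>\<close> by (intro power_mono) auto
    moreover have "0 < (real (j x) * \<delta>)\<^sup>2" using j(1)[OF x] \<open>0 < \<delta>\<close> by simp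
    ultimately have "1 / x\<^sup>2 \<le> 1 / (real (j x) * \<delta>)\<^sup>2" by (intro frac_le) auto
    then show "1 / x\<^sup>2 \<le> 1 / (real (j x))\<^sup>2 / \<delta>\<^sup>2" by (simp add: power_mult_distrib)
  qed
  also have "\<dots> = (\<Sum>k\<in>j ` X. 1 / (real k)\<^sup>2) / \<delta>\<^sup>2"
    by (simp add: sum.reindex[OF inj] sum_divide_distrib)
  also have "(\<Sum>k\<in>j ` X. 1 / (real k)\<^sup>2) \<le> (\<Sum>k=1..Max (j ` X). 1 / (real k)\<^sup>2)"
    using \<open>finite X\<close> j(1) by (intro sum_mono2) auto
  also have "\<dots> \<le> 2" by (rule sum_inverse_squares_le)
  finally show ?thesis using \<open>0 < \<delta>\<close> by (simp add: divide_right_mono)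
qed

lemma sum_inverse_squares_separated:
  fixes X :: "real set"
  assumes "finite X" "0 < \<delta>" and ge: "\<And>x. x \<in> X \<Longrightarrow> \<delta> \<le> \<bar>x\<bar>"
    and sep: "\<And>x y. x \<in> X \<Longrightarrow> y \<in> X \<Longrightarrow> x \<noteq> y \<Longrightarrow> \<delta> \<le> \<bar>x - y\<bar>"
  shows "(\<Sum>x\<in>X. 1 / x\<^sup>2) \<le> 4 / \<delta>\<^sup>2"
proof -
  let ?P = "{x \<in> X. 0 < x}" and ?N = "{x \<in> X. x < 0}"
  have X: "X = ?P \<union> ?N" using ge \<open>0 < \<delta>\<close> by force
  have "(\<Sum>x\<in>?P. 1 / x\<^sup>2) \<le> 2 / \<delta>\<^sup>2"
    using assms by (intro sum_inverse_squares_separated_pos) (auto dest: ge)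
  moreover have "(\<Sum>x\<in>uminus ` ?N. 1 / x\<^sup>2) \<le> 2 / \<delta>\<^sup>2"
  proof (rule sum_inverse_squares_separated_pos)
    fix x y assume "x \<in> uminus ` ?N" "y \<in> uminus ` ?N" "x \<noteq> y"
    then show "\<delta> \<le> \<bar>x - y\<bar>" using sep[of "- x" "- y"] by auto
  qed (use assms in force)+
  then have "(\<Sum>x\<in>?N. 1 / x\<^sup>2) \<le> 2 / \<delta>\<^sup>2"
    by (subst (asm) sum.reindex) auto
  moreover have "(\<Sum>x\<in>X. 1 / x\<^sup>2) = (\<Sum>x\<in>?P. 1 / x\<^sup>2) + (\<Sum>x\<in>?N. 1 / x\<^sup>2)"
    by (subst X, rule sum.union_disjoint) (use \<open>finite X\<close> in auto)
  ultimately show ?thesis by simp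
qed

lemma parabola_integral:
  assumes "0 \<le> L"
  shows "((\<lambda>t. complex_of_real (t * (L - t))) has_integral of_real (L ^ 3 / 6)) {0..L}"
proof -
  have "((\<lambda>t. t * (L - t)) has_integral (L * L\<^sup>2 / 2 - L ^ 3 / 3) - (L * 0\<^sup>2 / 2 - 0 ^ 3 / 3)) {0..L}"
    using assms by (intro fundamental_theorem_of_calculus)
      (auto intro!: derivative_eq_intros simp flip: has_real_derivative_iff_has_vector_derivative
        simp: field_simps power2_eq_square)
  then have "((\<lambda>t. t * (L - t)) has_integral L ^ 3 / 6) {0..L}"
    by (simp add: power2_eq_square power3_eq_cube mult.assoc)
  from has_integral_linear[OF this bounded_linear_of_real] show ?thesis
    unfolding o_def .
qed

text \<open>The weight vanishes at both ends, so the boundary terms of order 1/\<nu> disappear and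
  the decay is quadratic. The condition \<open>1 \<le> L * \<bar>\<nu>\<bar>\<close> absorbs the
  remaining cubic term.\<close>

lemma parabola_fourier_transform:
  assumes "0 \<le> L" "\<nu> \<noteq> 0" "1 \<le> L * \<bar>\<nu>\<bar>"
  shows "\<exists>J. ((\<lambda>t. complex_of_real (t * (L - t)) * cis (\<nu> * t)) has_integral J) {0..L} \<and>
    cmod J \<le> 6 * L / \<nu>\<^sup>2"
proof -
  define w where "w = \<i> * complex_of_real \<nu>"
  have w: "w \<noteq> 0" using assms by (simp add: w_def)
  \<comment> \<open>Antiderivative by repeated integration by parts: exp (w z) (p / w - p' / w^2 +
    p'' / w^3) for p = z (L - z).\<close>
  define g where "g z = exp (w * z) * (z * (of_real L - z) / w - (of_real L - 2 * z) / w\<^sup>2 - 2 / w ^ 3)" for z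
  have "(g has_field_derivative z * (of_real L - z) * exp (w * z)) (at z)" for z
    unfolding g_def using w
    by (auto intro!: derivative_eq_intros simp: field_simps power2_eq_square power3_eq_cube)
  then have "((\<lambda>t. g (of_real t)) has_vector_derivative
      of_real t * (of_real L - of_real t) * exp (w * of_real t)) (at t within {0..L})" for t
    by (rule has_vector_derivative_real_field)
  then have "((\<lambda>t. of_real t * (of_real L - of_real t) * exp (w * of_real t)) has_integral
      g (of_real L) - g (of_real 0)) {0..L}"
    using \<open>0 \<le> L\<close> by (intro fundamental_theorem_of_calculus) auto
  moreover have "exp (w * of_real t) = cis (\<nu> * t)" for t
    by (simp add: w_def cis_conv_exp mult_ac)
  ultimately have "((\<lambda>t. complex_of_real (t * (L - t)) * cis (\<nu> * t)) has_integral
      g (of_real L) - g 0) {0..L}" by simp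
  moreover have "cmod (g (of_real L) - g 0) \<le> 6 * L / \<nu>\<^sup>2"
  proof -
    have E: "cmod (exp (w * of_real L)) = 1" by (simp add: w_def)
    have nw: "cmod w = \<bar>\<nu>\<bar>" by (simp add: w_def norm_mult)
    have a: "cmod (of_real L / w\<^sup>2 - 2 / w ^ 3) \<le> L / \<nu>\<^sup>2 + 2 / \<bar>\<nu>\<bar> ^ 3"
      using \<open>0 \<le> L\<close> by (intro order_trans[OF norm_triangle_ineq4])
        (simp add: norm_divide norm_power nw)
    have b: "cmod (of_real L / w\<^sup>2 + 2 / w ^ 3) \<le> L / \<nu>\<^sup>2 + 2 / \<bar>\<nu>\<bar> ^ 3"
      using \<open>0 \<le> L\<close> by (intro order_trans[OF norm_triangle_ineq])
        (simp add: norm_divide norm_power nw)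
    have "g (of_real L) - g 0 = exp (w * of_real L) * (of_real L / w\<^sup>2 - 2 / w ^ 3)
        + (of_real L / w\<^sup>2 + 2 / w ^ 3)"
      by (simp add: g_def algebra_simps minus_divide_left[symmetric])
    also have "cmod \<dots> \<le> 2 * (L / \<nu>\<^sup>2 + 2 / \<bar>\<nu>\<bar> ^ 3)"
    proof (rule order_trans[OF norm_triangle_ineq])
      show "cmod (exp (w * of_real L) * (of_real L / w\<^sup>2 - 2 / w ^ 3)) +
          cmod (of_real L / w\<^sup>2 + 2 / w ^ 3) \<le> 2 * (L / \<nu>\<^sup>2 + 2 / \<bar>\<nu>\<bar> ^ 3)"
        using add_mono[OF a b] by (simp only: norm_mult E mult_1_left mult_2)
    qed
    also have "2 / \<bar>\<nu>\<bar> ^ 3 \<le> 2 * L / \<nu>\<^sup>2"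
    proof -
      have "2 / \<bar>\<nu>\<bar> ^ 3 * 1 \<le> 2 / \<bar>\<nu>\<bar> ^ 3 * (L * \<bar>\<nu>\<bar>)"
        using assms by (intro mult_left_mono) auto
      also have "\<dots> = 2 * L / \<nu>\<^sup>2"
        using assms(2) by (simp add: power3_eq_cube power2_eq_square abs_mult_self_eq field_simps)
      finally show ?thesis by simp
    qed
    finally show ?thesis by simp
  qed
  ultimately show ?thesis by blast
qed

text \<open>After expanding the square, the diagonal contributes exactly
  \<open>L ^ 3 / 6 * s\<close>. Separation and the length of the window keep the off-diagonal part
  within half of that.\<close>

lemma ingham_inequality:
  fixes a :: "'q \<Rightarrow> complex" and \<nu> :: "'q \<Rightarrow> real"
  assumes "finite Q" "0 < \<delta>" and sep: "\<And>p q. p \<in> Q \<Longrightarrow> q \<in> Q \<Longrightarrow> p \<noteq> q \<Longrightarrow> \<delta> \<le> \<bar>\<nu> p - \<nu> q\<bar>"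
    and L: "17 \<le> L * \<delta>"
  defines "f \<equiv> \<lambda>t. t * (L - t) * (cmod (\<Sum>q\<in>Q. a q * cis (\<nu> q * t)))\<^sup>2"
    and "s \<equiv> \<Sum>q\<in>Q. (cmod (a q))\<^sup>2"
  shows "\<exists>J. (f has_integral J) {0..L} \<and> L ^ 3 / 12 * s \<le> J \<and> J \<le> L ^ 3 / 4 * s"
proof -
  have Lpos: "0 < L" using L \<open>0 < \<delta>\<close> by (smt (verit) mult_nonpos_nonneg)
  define g where "g p q t = complex_of_real (t * (L - t)) * cis ((\<nu> p - \<nu> q) * t)" for p q t
  define k where "k p q = 6 * L / (\<nu> p - \<nu> q)\<^sup>2" for p q
  define e where "e p q = (if p = q then complex_of_real (L ^ 3 / 6) else 0)" for p q :: 'q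
  have "\<exists>J. (g p q has_integral J) {0..L} \<and>
      cmod (J - e p q) \<le> (if p = q then 0 else k p q)"
    if "p \<in> Q" "q \<in> Q" for p q
  proof (cases "p = q")
    case True
    then show ?thesis unfolding g_def e_def using parabola_integral[of L] Lpos
      by (intro exI[of _ "of_real (L ^ 3 / 6)"]) auto
  next
    case False
    have "\<delta> \<le> \<bar>\<nu> p - \<nu> q\<bar>" using sep that False by auto
    then have "L * \<delta> \<le> L * \<bar>\<nu> p - \<nu> q\<bar>" using Lpos by simp
    then have "1 \<le> L * \<bar>\<nu> p - \<nu> q\<bar>" using L by linarith
    have "\<nu> p - \<nu> q \<noteq> 0" using \<open>\<delta> \<le> _\<close> \<open>0 < \<delta>\<close> by auto
    from parabola_fourier_transform[OF less_imp_le[OF Lpos] this \<open>1 \<le> _\<close>] False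
    show ?thesis unfolding g_def e_def k_def by simp
  qed
  then obtain J where J: "\<And>p q. p \<in> Q \<Longrightarrow> q \<in> Q \<Longrightarrow>
      (g p q has_integral J p q) {0..L}"
    and Jk: "\<And>p q. p \<in> Q \<Longrightarrow> q \<in> Q \<Longrightarrow>
      cmod (J p q - e p q) \<le> (if p = q then 0 else k p q)"
    by metis
  define I where "I = (\<Sum>p\<in>Q. \<Sum>q\<in>Q. a p * cnj (a q) * J p q)"
  have "((\<lambda>t. \<Sum>p\<in>Q. \<Sum>q\<in>Q. a p * cnj (a q) * g p q t)
      has_integral I) {0..L}"
    unfolding I_def using J \<open>finite Q\<close> by (intro has_integral_sum has_integral_mult_right) auto
  moreover have "(\<Sum>p\<in>Q. \<Sum>q\<in>Q. a p * cnj (a q) * g p q t)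
      = of_real (f t)" for t
  proof -
    have "of_real (f t) = of_real (t * (L - t)) *
        ((\<Sum>p\<in>Q. a p * cis (\<nu> p * t)) * cnj (\<Sum>q\<in>Q. a q * cis (\<nu> q * t)))"
      unfolding f_def by (simp only: of_real_mult complex_norm_square)
    also have "\<dots> = (\<Sum>p\<in>Q. \<Sum>q\<in>Q. of_real (t * (L - t)) *
        ((a p * cis (\<nu> p * t)) * (cnj (a q) * cis (- (\<nu> q * t)))))"
      unfolding cnj_sum sum_product unfolding sum_distrib_left by (simp add: cis_cnj)
    also have "\<dots> = (\<Sum>p\<in>Q. \<Sum>q\<in>Q. a p * cnj (a q) * (of_real (t * (L - t)) *
        (cis (\<nu> p * t) * cis (- (\<nu> q * t)))))"
      by (simp only: mult_ac)
    finally show ?thesis by (simp add: g_def cis_mult left_diff_distrib)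
  qed
  ultimately have cI: "((\<lambda>t. complex_of_real (f t)) has_integral I) {0..L}" by simp
  from has_integral_linear[OF this bounded_linear_Re]
  have fI: "(f has_integral Re I) {0..L}" by (simp add: o_def)
  have k4: "(\<Sum>q\<in>Q - {p}. k p q) \<le> 24 * L / \<delta>\<^sup>2" if p: "p \<in> Q" for p
  proof -
    have inj: "inj_on (\<lambda>q. \<nu> p - \<nu> q) (Q - {p})"
      using sep \<open>0 < \<delta>\<close> by (force intro!: inj_onI)
    have "(\<Sum>x\<in>(\<lambda>q. \<nu> p - \<nu> q) ` (Q - {p}). 1 / x\<^sup>2) \<le> 4 / \<delta>\<^sup>2"
    proof (rule sum_inverse_squares_separated)
      fix x y assume "x \<in> (\<lambda>q. \<nu> p - \<nu> q) ` (Q - {p})" "y \<in> (\<lambda>q. \<nu> p - \<nu> q) ` (Q - {p})" "x \<noteq> y"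
      then obtain q q' where "q \<in> Q" "q' \<in> Q" "q \<noteq> q'" "x = \<nu> p - \<nu> q" "y = \<nu> p - \<nu> q'" by auto
      then show "\<delta> \<le> \<bar>x - y\<bar>" using sep[of q' q] by auto
    qed (use assms p in auto)
    then have "(\<Sum>q\<in>Q - {p}. 1 / (\<nu> p - \<nu> q)\<^sup>2) \<le> 4 / \<delta>\<^sup>2" by (simp add: sum.reindex[OF inj])
    then have "6 * L * (\<Sum>q\<in>Q - {p}. 1 / (\<nu> p - \<nu> q)\<^sup>2) \<le> 6 * L * (4 / \<delta>\<^sup>2)"
      using Lpos by (intro mult_left_mono) auto
    then show ?thesis by (simp add: k_def sum_distrib_left)
  qed
  have k0: "0 \<le> k p q" and ksym: "k p q = k q p" for p q
    using Lpos by (auto simp: k_def power2_commute)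
  have "cmod (I - of_real (L ^ 3 / 6 * s)) \<le> 24 * L / \<delta>\<^sup>2 * s"
  proof -
    let ?A = "\<lambda>p. cmod (a p)"
    have "of_real (L ^ 3 / 6 * s) = (\<Sum>p\<in>Q. \<Sum>q\<in>Q. a p * cnj (a q) * e p q)"
    proof -
      have "(\<Sum>q\<in>Q. a p * cnj (a q) * e p q)
          = of_real (L ^ 3 / 6) * of_real ((?A p)\<^sup>2)" if "p \<in> Q" for p
        using that \<open>finite Q\<close> by (simp add: e_def if_distrib[of "\<lambda>x. _ * x"] sum.delta' complex_norm_square del: of_real_power cong: if_cong)
      then have "(\<Sum>p\<in>Q. \<Sum>q\<in>Q. a p * cnj (a q) * e p q) =
          (\<Sum>p\<in>Q. of_real (L ^ 3 / 6) * of_real ((?A p)\<^sup>2))" by (rule sum.cong[OF refl])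
      then show ?thesis by (simp only: s_def sum_distrib_left of_real_sum of_real_mult)
    qed
    then have "I - of_real (L ^ 3 / 6 * s) = (\<Sum>p\<in>Q. \<Sum>q\<in>Q. a p * cnj (a q) *
        (J p q - e p q))"
      unfolding I_def by (simp only: right_diff_distrib sum_subtractf)
    also have "cmod \<dots> \<le> (\<Sum>p\<in>Q. \<Sum>q\<in>Q. ?A p * ?A q * (if p = q then 0 else k p q))"
    proof (intro order_trans[OF norm_sum] sum_mono)
      fix p q assume "p \<in> Q" "q \<in> Q"
      then show "cmod (a p * cnj (a q) * (J p q - e p q)) \<le> ?A p * ?A q * (if p = q then 0 else k p q)"
        unfolding norm_mult complex_mod_cnj by (intro mult_left_mono Jk) auto
    qed
    \<comment> \<open>Schur test: \<open>k\<close> is symmetric, so after splitting each product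
      into squares both halves reduce to the row sums bounded in \<open>k4\<close>.\<close>
    also have "\<dots> \<le> (\<Sum>p\<in>Q. \<Sum>q\<in>Q. ((?A p)\<^sup>2 / 2 + (?A q)\<^sup>2 / 2) * (if p = q then 0 else k p q))"
    proof (intro sum_mono mult_right_mono)
      fix p q show "?A p * ?A q \<le> (?A p)\<^sup>2 / 2 + (?A q)\<^sup>2 / 2"
        using sum_squares_bound[of "?A p" "?A q"] by simp
    qed (simp add: k0)
    also have "\<dots> = (\<Sum>p\<in>Q. \<Sum>q\<in>Q. (?A p)\<^sup>2 / 2 * (if p = q then 0 else k p q)) +
        (\<Sum>p\<in>Q. \<Sum>q\<in>Q. (?A q)\<^sup>2 / 2 * (if p = q then 0 else k p q))"
      by (simp only: distrib_right sum.distrib)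
    also have "(\<Sum>p\<in>Q. \<Sum>q\<in>Q. (?A q)\<^sup>2 / 2 * (if p = q then 0 else k p q)) =
        (\<Sum>q\<in>Q. \<Sum>p\<in>Q. (?A q)\<^sup>2 / 2 * (if q = p then 0 else k q p))"
      by (subst sum.swap) (intro sum.cong refl, auto intro: ksym)
    also have "(\<Sum>p\<in>Q. \<Sum>q\<in>Q. (?A p)\<^sup>2 / 2 * (if p = q then 0 else k p q)) +
        (\<Sum>p\<in>Q. \<Sum>q\<in>Q. (?A p)\<^sup>2 / 2 * (if p = q then 0 else k p q)) =
        (\<Sum>p\<in>Q. (?A p)\<^sup>2 * (\<Sum>q\<in>Q. if p = q then 0 else k p q))"
      by (simp add: sum.distrib[symmetric] sum_distrib_left)
    also have "\<dots> = (\<Sum>p\<in>Q. (?A p)\<^sup>2 * (\<Sum>q\<in>Q - {p}. k p q))"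
      using \<open>finite Q\<close> by (intro sum.cong refl arg_cong2[where f = "(*)"] sum.mono_neutral_cong_right) auto
    also have "\<dots> \<le> (\<Sum>p\<in>Q. (?A p)\<^sup>2 * (24 * L / \<delta>\<^sup>2))"
      by (intro sum_mono mult_left_mono k4) auto
    also have "\<dots> = 24 * L / \<delta>\<^sup>2 * s"
      unfolding s_def sum_distrib_right[symmetric] by (rule mult.commute)
    finally show ?thesis .
  qed
  moreover have "24 * L / \<delta>\<^sup>2 * s \<le> L ^ 3 / 12 * s"
  proof (rule mult_right_mono)
    \<comment> \<open>Origin of the 17: its square 289 exceeds 288 = 24 * 12, which makes the
      off-diagonal bound at most half of the diagonal.\<close>
    have "17\<^sup>2 \<le> (L * \<delta>)\<^sup>2" using L by (intro power_mono) auto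
    then have "288 \<le> (L * \<delta>)\<^sup>2" by simp
    then have "288 * L \<le> (L * \<delta>)\<^sup>2 * L" using Lpos by simp
    then show "24 * L / \<delta>\<^sup>2 \<le> L ^ 3 / 12"
      using \<open>0 < \<delta>\<close> by (simp add: field_simps power2_eq_square power3_eq_cube)
  qed (simp add: s_def sum_nonneg)
  moreover have "\<bar>Re I - L ^ 3 / 6 * s\<bar> \<le> cmod (I - of_real (L ^ 3 / 6 * s))"
    using abs_Re_le_cmod[of "I - of_real (L ^ 3 / 6 * s)"] by simp
  ultimately have "\<bar>Re I - L ^ 3 / 6 * s\<bar> \<le> L ^ 3 / 12 * s" by linarith
  moreover define X where "X = L ^ 3 * s"
  ultimately have "\<bar>Re I - X / 6\<bar> \<le> X / 12" by simp
  then have "X / 12 \<le> Re I" "Re I \<le> X / 4" by linarith+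
  then have "L ^ 3 / 12 * s \<le> Re I" "Re I \<le> L ^ 3 / 4 * s" by (simp_all add: X_def)
  with fI show ?thesis by blast
qed

section \<open>Linear flows on tori\<close>

lemma tclass_add: "tclass (x + y) = tclass x * tclass y"
  by (simp add: tclass_def vec_eq_iff cis_mult)

lemma tclass_0 [simp]: "tclass 0 = 1"
  by (simp add: tclass_def vec_eq_iff)

lemma tclass_in_torus [simp]: "tclass x \<in> torus"
  by (simp add: tclass_def torus_def)

lemma torus_mult: "x \<in> torus \<Longrightarrow> y \<in> torus \<Longrightarrow> x * y \<in> torus"
  by (simp add: torus_def norm_mult)

text \<open>A torus point determines its representative only modulo periods, so congruence survives
  integer multiples but not arbitrary real ones.\<close>

lemma tclass_scaleR_of_int:
  assumes "tclass x = tclass y"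
  shows "tclass (of_int k *\<^sub>R x) = tclass (of_int k *\<^sub>R y)"
proof -
  have "cis (x $ j) = cis (y $ j)" for j
    using assms by (simp add: tclass_def vec_eq_iff)
  then have "cis (x $ j) powi k = cis (y $ j) powi k" for j by simp
  then show ?thesis by (simp add: tclass_def vec_eq_iff cis_power_int)
qed

lemma continuous_on_tclass [continuous_intros]:
  "continuous_on S f \<Longrightarrow> continuous_on S (\<lambda>x. tclass (f x))"
  unfolding tclass_def cis_conv_exp by (intro continuous_intros)

lemma compact_torus: "compact (torus :: (complex ^ 'n) set)"
proof -
  have "closed (torus :: (complex ^ 'n) set)"
    unfolding torus_def by (intro closed_Collect_all closed_Collect_eq continuous_intros)
  moreover have "norm z \<le> real CARD('n)" if "z \<in> torus" for z :: "complex ^ 'n"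
    using that L2_set_le_sum[of "UNIV :: 'n set" "\<lambda>j. norm (z $ j)"] by (simp add: norm_vec_def torus_def)
  then have "bounded (torus :: (complex ^ 'n) set)" by (auto simp: bounded_iff)
  ultimately show ?thesis by (simp add: compact_eq_bounded_closed)
qed

lemma tclass_in_orbit_closure: "tclass (t *\<^sub>R l) \<in> orbit_closure l"
  unfolding orbit_closure_def using closure_subset by fast

text \<open>Near 1 the principal logarithm satisfies |Ln z| \<le> 2 |z - 1|, which gives a small
  representative of each coordinate. Bounding the Euclidean norm by the l^1 norm contributes
  \<open>CARD('n)\<close>.\<close>

lemma small_representative:
  fixes x :: "real ^ 'n"
  assumes "\<And>j. cmod (1 - cis (x $ j)) \<le> \<epsilon>" "\<epsilon> < 1 / 2"
  shows "\<exists>w. tclass w = tclass x \<and> norm w \<le> 2 * real CARD('n) * \<epsilon>"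
proof -
  have "\<exists>w. cis w = cis (x $ j) \<and> \<bar>w\<bar> \<le> 2 * \<epsilon>" for j
  proof -
    define z where "z = cis (x $ j)"
    have z: "cmod z = 1" "z \<noteq> 0" by (auto simp: z_def)
    have n: "cmod (z - 1) \<le> \<epsilon>" using assms(1)[of j] by (simp add: z_def norm_minus_commute)
    have "Re (Ln z) = 0" using z by simp
    then have "Ln z = \<i> * of_real (Im (Ln z))" by (simp add: complex_eq_iff)
    then have "cis (Im (Ln z)) = z" using z(2) by (metis cis_conv_exp exp_Ln)
    moreover have "cmod (Ln (1 + (z - 1))) \<le> 2 * cmod (z - 1)"
      using n assms(2) by (intro norm_Ln_le) auto
    then have "\<bar>Im (Ln z)\<bar> \<le> 2 * \<epsilon>"
      using abs_Im_le_cmod[of "Ln z"] n by simp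
    ultimately show ?thesis unfolding z_def by blast
  qed
  then obtain w where w: "\<And>j. cis (w j) = cis (x $ j)" "\<And>j. \<bar>w j\<bar> \<le> 2 * \<epsilon>" by metis
  have "norm (\<chi> j. w j) \<le> (\<Sum>j\<in>(UNIV :: 'n set). 2 * \<epsilon>)"
    using w(2) by (intro order_trans[OF norm_le_l1_cart] sum_mono) auto
  with w(1) show ?thesis
    by (intro exI[of _ "\<chi> j. w j"]) (simp add: tclass_def mult_ac)
qed

lemma torus_eq_range_tclass: "torus = range tclass"
proof (intro subset_antisym subsetI)
  fix z :: "complex ^ 'n" assume "z \<in> torus"
  then have 1: "cmod (z $ j) = 1" for j by (simp add: torus_def)
  have "cis (Arg (z $ j)) = z $ j" for j
  proof -
    have "z $ j \<noteq> 0" using 1[of j] by auto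
    from cis_Arg[OF this] show ?thesis by (simp add: sgn_eq 1)
  qed
  then have "z = tclass (\<chi> j. Arg (z $ j))" by (simp add: tclass_def vec_eq_iff)
  then show "z \<in> range tclass" by blast
qed auto

section \<open>Quantitative density of Diophantine orbits\<close>

text \<open>Frequencies are integer-valued functions, so that boxes of them are \<open>PiE\<close>
  sets and a shift of one coordinate is a function update.\<close>

definition int_sup_norm :: "('r::finite \<Rightarrow> int) \<Rightarrow> int" where
  "int_sup_norm q = Max (range (\<lambda>j. \<bar>q j\<bar>))"

lemma int_sup_norm_le_iff: "int_sup_norm q \<le> k \<longleftrightarrow> (\<forall>j. \<bar>q j\<bar> \<le> k)"
  by (simp add: int_sup_norm_def)

lemma abs_le_int_sup_norm: "\<bar>q j\<bar> \<le> int_sup_norm q"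
  using int_sup_norm_le_iff[of q "int_sup_norm q"] by simp

lemma int_sup_norm_shift: "\<bar>int_sup_norm (q(j := q j - 1)) - int_sup_norm q\<bar> \<le> 1"
proof -
  have "int_sup_norm p \<le> int_sup_norm q + 1" if "\<And>i. \<bar>p i - q i\<bar> \<le> 1" for p q :: "'a \<Rightarrow> int"
    unfolding int_sup_norm_le_iff
  proof
    fix i show "\<bar>p i\<bar> \<le> int_sup_norm q + 1"
      using that[of i] abs_le_int_sup_norm[of q i] by linarith
  qed
  note le = this
  have "int_sup_norm q \<le> int_sup_norm (q(j := q j - 1)) + 1" by (rule le) simp
  moreover have "int_sup_norm (q(j := q j - 1)) \<le> int_sup_norm q + 1" by (rule le) simp
  ultimately show ?thesis by linarith
qed

text \<open>The coefficients \<open>c q = max 0 (2 m - \<bar>q\<bar>)\<close> have differences of size at most \<open>1\<close>, so multiplying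
  the trigonometric polynomial \<open>P\<close> by \<open>1 - e\<^bsup>i x\<^sub>j\<^esup>\<close> shrinks its \<open>\<ell>\<^sup>2\<close> norm by a factor of order \<open>1 / m\<close>.
  Ingham's inequality transfers this to weighted \<open>L\<^sup>2\<close> norms along the orbit, which is impossible if
  the orbit stays far from \<open>y\<close>.\<close>

lemma orbit_hits_box:
  fixes \<beta> y :: "real ^ 'r" and m :: nat
  assumes m: "1 \<le> m" and \<delta>: "0 < \<delta>"
    and sep: "\<And>q :: 'r \<Rightarrow> int. q \<noteq> (\<lambda>_. 0) \<Longrightarrow> \<forall>j. \<bar>q j\<bar> \<le> 4 * int m + 1 \<Longrightarrow>
      \<delta> \<le> \<bar>\<Sum>j\<in>UNIV. of_int (q j) * \<beta> $ j\<bar>"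
  shows "\<exists>t. 0 \<le> t \<and> t \<le> 17 / \<delta> \<and>
    (\<Sum>j\<in>UNIV. (cmod (1 - cis (t * \<beta> $ j - y $ j)))\<^sup>2) \<le> 4 * real CARD('r) * 2 ^ CARD('r) / (real m)\<^sup>2"
proof (rule ccontr)
  \<comment> \<open>The shortest window that \<open>ingham_inequality\<close> admits for the gap
    \<delta>.\<close>
  define L where "L = 17 / \<delta>"
  \<comment> \<open>Chosen so that the comparison ends in 4 X \<le> 3 X with X > 0. The 3 is the
    ratio of the constants L^3 / 4 and L^3 / 12, and the power of 2 is the ratio of the sizes of
    \<open>Q\<close> and of the cube of radius \<open>m\<close>.\<close>
  define \<eta> where "\<eta> = 4 * real CARD('r) * 2 ^ CARD('r) / (real m)\<^sup>2"
  assume "\<not> ?thesis"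
  then have far: "\<eta> < (\<Sum>j\<in>UNIV. (cmod (1 - cis (t * \<beta> $ j - y $ j)))\<^sup>2)" if "0 \<le> t" "t \<le> L" for t
    using that unfolding L_def \<eta>_def by (meson not_le)
  have L: "17 \<le> L * \<delta>" "0 < L" using \<delta> by (auto simp: L_def)
  \<comment> \<open>The support of \<open>c\<close> lies in |q_j| < 2 m, and the extra layer on top
    makes room for its shift by one. The side of 2 (2 m + 1) points bounds coordinate differences by
    4 m + 1, as required for \<open>sep\<close>.\<close>
  define Q where "Q = PiE (UNIV :: 'r set) (\<lambda>_. {- 2 * int m..2 * int m + 1})"
  have finQ: "finite Q" unfolding Q_def by (intro finite_PiE) auto
  have Q: "q \<in> Q \<longleftrightarrow> (\<forall>j. - 2 * int m \<le> q j \<and> q j \<le> 2 * int m + 1)" for q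
    by (auto simp: Q_def PiE_iff)
  have cardQ: "real (card Q) = 2 ^ CARD('r) * (2 * real m + 1) ^ CARD('r)"
  proof -
    have "real (card Q) = (2 * (2 * real m + 1)) ^ CARD('r)" by (simp add: Q_def card_PiE algebra_simps)
    then show ?thesis by (simp only: power_mult_distrib)
  qed
  define c :: "('r \<Rightarrow> int) \<Rightarrow> real" where "c q = of_int (max 0 (2 * int m - int_sup_norm q))" for q
  define sh where "sh j q = q(j := q j - 1)" for j and q :: "'r \<Rightarrow> int"
  define d where "d j q = c q - c (sh j q)" for j q
  define \<nu> where "\<nu> q = (\<Sum>j\<in>UNIV. of_int (q j) * \<beta> $ j)" for q :: "'r \<Rightarrow> int"
  define \<phi> where "\<phi> q = (\<Sum>j\<in>UNIV. of_int (q j) * y $ j)" for q :: "'r \<Rightarrow> int"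
  \<comment> \<open>The phase \<open>cis (- \<phi> q)\<close> recentres the polynomial at
    \<open>y\<close>.\<close>
  define E where "E t q = cis (- \<phi> q) * cis (\<nu> q * t)" for t q
  define P where "P t = (\<Sum>q\<in>Q. of_real (c q) * E t q)" for t
  have c0: "c q = 0" if "2 * int m \<le> \<bar>q j\<bar>" for q j
    using abs_le_int_sup_norm[of q j] that by (simp add: c_def)
  have sep': "\<delta> \<le> \<bar>\<nu> p - \<nu> q\<bar>" if "p \<in> Q" "q \<in> Q" "p \<noteq> q" for p q
  proof -
    have "\<bar>p j - q j\<bar> \<le> 4 * int m + 1" for j
    proof -
      have "- 2 * int m \<le> p j" "p j \<le> 2 * int m + 1" "- 2 * int m \<le> q j" "q j \<le> 2 * int m + 1"
        using that(1,2) Q by blast+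
      then show ?thesis by linarith
    qed
    moreover have "(\<lambda>j. p j - q j) \<noteq> (\<lambda>_. 0)" using that(3) by (auto simp: fun_eq_iff)
    ultimately show ?thesis
      using sep[of "\<lambda>j. p j - q j"] by (simp add: \<nu>_def left_diff_distrib sum_subtractf)
  qed
  have shE: "E t q = E t (sh j q) * cis (t * \<beta> $ j - y $ j)" for t q j
  proof -
    have "(\<Sum>i\<in>UNIV. of_int (q i) * v $ i) = (\<Sum>i\<in>UNIV. of_int (sh j q i) * v $ i) + v $ j"
      for v :: "real ^ 'r"
      by (simp add: sum.remove[of UNIV j] sh_def algebra_simps)
    from this[of \<beta>] this[of y] show ?thesis
      by (simp add: E_def \<nu>_def \<phi>_def cis_mult algebra_simps)
  qed
  have shift: "P t * (1 - cis (t * \<beta> $ j - y $ j)) = (\<Sum>q\<in>Q. of_real (d j q) * E t q)" for t j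
  proof -
    have "P t * cis (t * \<beta> $ j - y $ j) = (\<Sum>q\<in>Q. of_real (c q) * (E t q * cis (t * \<beta> $ j - y $ j)))"
      by (simp add: P_def sum_distrib_right mult.assoc)
    \<comment> \<open>Only the support of \<open>c\<close> is reindexed: the shift does not preserve
      \<open>Q\<close>, but it keeps this support inside.\<close>
    also have "\<dots> = (\<Sum>q\<in>{q \<in> Q. c q \<noteq> 0}. of_real (c q) * (E t q * cis (t * \<beta> $ j - y $ j)))"
      using finQ by (intro sum.mono_neutral_right) auto
    also have "\<dots> = (\<Sum>q\<in>{q \<in> Q. c (sh j q) \<noteq> 0}. of_real (c (sh j q)) * E t q)"
    proof (rule sum.reindex_bij_witness[of _ "sh j" "\<lambda>q. q(j := q j + 1)"])
      fix q assume q: "q \<in> {q \<in> Q. c q \<noteq> 0}"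
      then have "\<bar>q j\<bar> < 2 * int m" using c0[of q j] by force
      moreover have "sh j (q(j := q j + 1)) = q" by (simp add: sh_def)
      ultimately show "q(j := q j + 1) \<in> {q \<in> Q. c (sh j q) \<noteq> 0}"
        using q by (auto simp: Q)
      show "sh j (q(j := q j + 1)) = q" by fact
      show "complex_of_real (c (sh j (q(j := q j + 1)))) * E t (q(j := q j + 1)) =
          of_real (c q) * (E t q * cis (t * \<beta> $ j - y $ j))"
        using shE[of t "q(j := q j + 1)" j] by (simp add: \<open>sh j (q(j := q j + 1)) = q\<close>)
    next
      fix q assume q: "q \<in> {q \<in> Q. c (sh j q) \<noteq> 0}"
      then have "\<bar>sh j q j\<bar> < 2 * int m" using c0[of "sh j q" j] by force
      with q show "sh j q \<in> {q \<in> Q. c q \<noteq> 0}" by (auto simp: Q sh_def)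
      show "(sh j q)(j := sh j q j + 1) = q" by (simp add: sh_def)
    qed
    also have "\<dots> = (\<Sum>q\<in>Q. of_real (c (sh j q)) * E t q)"
      using finQ by (intro sum.mono_neutral_left) auto
    finally show ?thesis
      by (simp add: d_def P_def right_diff_distrib left_diff_distrib sum_subtractf)
  qed
  have ingham: "\<exists>J. ((\<lambda>t. t * (L - t) * (cmod (\<Sum>q\<in>Q. of_real (g q) * E t q))\<^sup>2) has_integral J) {0..L}
      \<and> L ^ 3 / 12 * (\<Sum>q\<in>Q. (g q)\<^sup>2) \<le> J \<and> J \<le> L ^ 3 / 4 * (\<Sum>q\<in>Q. (g q)\<^sup>2)" for g :: "_ \<Rightarrow> real"
    using ingham_inequality[OF finQ \<delta> sep' L(1), where a = "\<lambda>q. of_real (g q) * cis (- \<phi> q)"]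
    by (simp add: E_def mult.assoc norm_mult)
  from ingham[of c, folded P_def] obtain J0 where J0: "((\<lambda>t. t * (L - t) * (cmod (P t))\<^sup>2) has_integral J0) {0..L}"
    "L ^ 3 / 12 * (\<Sum>q\<in>Q. (c q)\<^sup>2) \<le> J0" by blast
  define f where "f j t = t * (L - t) * (cmod (P t * (1 - cis (t * \<beta> $ j - y $ j))))\<^sup>2" for j t
  have "\<exists>J. (f j has_integral J) {0..L} \<and> J \<le> L ^ 3 / 4 * (\<Sum>q\<in>Q. (d j q)\<^sup>2)" for j
    using ingham[of "d j"] unfolding f_def shift by blast
  then obtain J where J: "\<And>j. (f j has_integral J j) {0..L}"
    "\<And>j. J j \<le> L ^ 3 / 4 * (\<Sum>q\<in>Q. (d j q)\<^sup>2)" by metis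
  have "((\<lambda>t. \<eta> * (t * (L - t) * (cmod (P t))\<^sup>2)) has_integral \<eta> * J0) {0..L}"
    using J0(1) by (rule has_integral_mult_right)
  moreover have "((\<lambda>t. \<Sum>j\<in>UNIV. f j t) has_integral (\<Sum>j\<in>UNIV. J j)) {0..L}"
    using J(1) by (intro has_integral_sum) auto
  \<comment> \<open>The assumption that the orbit stays far from \<open>y\<close> is integrated
    against the nonnegative weight t (L - t) |P t|^2.\<close>
  ultimately have "\<eta> * J0 \<le> (\<Sum>j\<in>UNIV. J j)"
  proof (rule has_integral_le)
    fix t assume t: "t \<in> {0..L}"
    then have "t * (L - t) * (cmod (P t))\<^sup>2 * \<eta> \<le>
        t * (L - t) * (cmod (P t))\<^sup>2 * (\<Sum>j\<in>UNIV. (cmod (1 - cis (t * \<beta> $ j - y $ j)))\<^sup>2)"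
      using far[of t] by (intro mult_left_mono) auto
    then show "\<eta> * (t * (L - t) * (cmod (P t))\<^sup>2) \<le>
        (\<Sum>j\<in>UNIV. f j t)"
      by (simp add: f_def norm_mult power_mult_distrib sum_distrib_left mult_ac)
  qed
  also have "(\<Sum>j\<in>UNIV. J j) \<le> (\<Sum>j\<in>(UNIV :: 'r set). L ^ 3 / 4 * real (card Q))"
  proof (intro sum_mono order_trans[OF J(2)] mult_left_mono)
    fix j
    have "(\<Sum>q\<in>Q. (d j q)\<^sup>2) \<le> (\<Sum>q\<in>Q. 1)"
    proof (rule sum_mono)
      fix q
      have "\<bar>d j q\<bar> \<le> 1"
      proof -
        have "\<bar>max 0 (2 * int m - int_sup_norm q) - max 0 (2 * int m - int_sup_norm (sh j q))\<bar> \<le> 1"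
          using int_sup_norm_shift[of q j] unfolding sh_def by linarith
        then show ?thesis unfolding d_def c_def by linarith
      qed
      then show "(d j q)\<^sup>2 \<le> 1" by (simp add: abs_square_le_1)
    qed
    then show "(\<Sum>q\<in>Q. (d j q)\<^sup>2) \<le> real (card Q)" by simp
  qed (use L in auto)
  also have "\<dots> = L ^ 3 / 12 * (3 * real CARD('r) * real (card Q))" by simp
  finally have "\<eta> * J0 \<le> L ^ 3 / 12 * (3 * real CARD('r) * real (card Q))" .
  \<comment> \<open>On the cube of radius \<open>m\<close> every coefficient is at least
    \<open>m\<close>; these frequencies alone supply the lower bound.\<close>
  moreover have "L ^ 3 / 12 * (\<eta> * ((real m)\<^sup>2 * (2 * real m + 1) ^ CARD('r))) \<le> \<eta> * J0"
  proof -
    let ?B = "PiE (UNIV :: 'r set) (\<lambda>_. {- int m..int m})"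
    have "(real m)\<^sup>2 * (2 * real m + 1) ^ CARD('r) = (\<Sum>q\<in>?B. (real m)\<^sup>2)"
      by (simp add: card_PiE algebra_simps)
    also have "\<dots> \<le> (\<Sum>q\<in>?B. (c q)\<^sup>2)"
    proof (intro sum_mono power_mono)
      fix q assume "q \<in> ?B"
      then have "q j \<in> {- int m..int m}" for j by (auto dest: PiE_mem)
      then have "int_sup_norm q \<le> int m" by (auto simp: int_sup_norm_le_iff abs_le_iff minus_le_iff)
      then show "real m \<le> c q" unfolding c_def by linarith
    qed auto
    also have "\<dots> \<le> (\<Sum>q\<in>Q. (c q)\<^sup>2)"
    proof (rule sum_mono2)
      show "?B \<subseteq> Q" unfolding Q_def by (intro PiE_mono) auto
    qed (use finQ in auto)
    finally have "L ^ 3 / 12 * ((real m)\<^sup>2 * (2 * real m + 1) ^ CARD('r)) \<le> L ^ 3 / 12 * (\<Sum>q\<in>Q. (c q)\<^sup>2)"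
      using L(2) by (intro mult_left_mono) auto
    also have "\<dots> \<le> J0" by (rule J0)
    finally have "\<eta> * (L ^ 3 / 12 * ((real m)\<^sup>2 * (2 * real m + 1) ^ CARD('r))) \<le> \<eta> * J0"
      by (intro mult_left_mono) (auto simp: \<eta>_def)
    then show ?thesis by (simp add: mult_ac)
  qed
  ultimately have "L ^ 3 / 12 * (\<eta> * ((real m)\<^sup>2 * (2 * real m + 1) ^ CARD('r))) \<le>
      L ^ 3 / 12 * (3 * real CARD('r) * real (card Q))" by linarith
  then have "\<eta> * ((real m)\<^sup>2 * (2 * real m + 1) ^ CARD('r)) \<le> 3 * real CARD('r) * real (card Q)"
    using L(2) by (subst (asm) mult_le_cancel_left_pos) auto
  then have "4 * (real CARD('r) * 2 ^ CARD('r) * (2 * real m + 1) ^ CARD('r)) \<le>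
      3 * (real CARD('r) * 2 ^ CARD('r) * (2 * real m + 1) ^ CARD('r))"
    using m by (simp add: \<eta>_def cardQ mult_ac)
  moreover have "0 < real CARD('r) * 2 ^ CARD('r) * (2 * real m + 1) ^ CARD('r)" by simp
  ultimately show False by linarith
qed

text \<open>Coordinates up to 4 m + 1 are at most 5 m, so the relevant frequency vectors have norm
  at most 5 r m and the Diophantine condition leaves a gap proportional to m^(-\<tau>). The
  two-sided bound on \<open>t\<close> makes it comparable to m^\<tau>.\<close>

lemma diophantine_orbit_hits:
  fixes \<beta> y :: "real ^ 'r"
  assumes dio: "diophantine \<beta> \<gamma> \<tau>" and \<gamma>: "0 < \<gamma>" and \<tau>: "0 < \<tau>"
  shows "\<exists>A>0. \<exists>D>0. \<forall>m::nat. D < real m \<longrightarrow> (\<exists>t w. A * real m powr \<tau> \<le> t \<and> t \<le> 2 * A * real m powr \<tau> \<and>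
    tclass (t *\<^sub>R \<beta> + w) = tclass y \<and> norm w \<le> D / real m)"
proof -
  define r where "r = real CARD('r)"
  have r: "1 \<le> r" by (simp add: r_def Suc_leI)
  have ge: "\<gamma> * norm q powr - \<tau> \<le> \<bar>q \<bullet> (\<beta> /\<^sub>R norm \<beta>)\<bar>" if "\<forall>j. q $ j \<in> \<int>" "q \<noteq> 0" for q
    using dio that unfolding diophantine_def by blast
  \<comment> \<open>For \<beta> = 0 the normalised vector is 0 by the convention for division by
    zero. Testing with (1, ..., 1) then contradicts the positive lower bound.\<close>
  have "\<beta> \<noteq> 0"
  proof
    assume "\<beta> = 0"
    define q :: "real ^ 'r" where "q = (\<chi> j. 1)"
    have "q \<noteq> 0" by (simp add: q_def vec_eq_iff)
    then have "0 < \<gamma> * norm q powr - \<tau>" using \<gamma> by simp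
    moreover have "\<gamma> * norm q powr - \<tau> \<le> \<bar>q \<bullet> (\<beta> /\<^sub>R norm \<beta>)\<bar>"
      using \<open>q \<noteq> 0\<close> by (intro ge) (auto simp: q_def)
    ultimately show False by (simp add: \<open>\<beta> = 0\<close>)
  qed
  define \<delta> where "\<delta> = norm \<beta> * \<gamma> * (5 * r) powr - \<tau>"
  have \<delta>: "0 < \<delta>" using \<open>\<beta> \<noteq> 0\<close> \<gamma> r by (simp add: \<delta>_def)
  define A where "A = 17 / \<delta>"
  define c where "c = sqrt (4 * r * 2 ^ CARD('r))"
  have c: "0 < c" using r by (simp add: c_def)
  \<comment> \<open>The factor 2 r comes from \<open>small_representative\<close>, applied with
    error c / m; since D \<ge> 2 c, the condition D < m ensures the required c / m < 1/2.\<close>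
  define D where "D = 2 * r * c"
  have D: "2 * c \<le> D" "0 < D" using c r by (auto simp: D_def)
  have hit: "\<exists>t w. A * real m powr \<tau> \<le> t \<and> t \<le> 2 * A * real m powr \<tau> \<and>
    tclass (t *\<^sub>R \<beta> + w) = tclass y \<and> norm w \<le> D / real m" if mD: "D < real m" for m
  proof -
    have m: "1 \<le> m" using mD D by (cases m) auto
    define T where "T = A * real m powr \<tau>"
    define \<delta>m where "\<delta>m = \<delta> * real m powr - \<tau>"
    have \<delta>m: "0 < \<delta>m" using \<delta> m by (simp add: \<delta>m_def)
    have T: "17 / \<delta>m = T" by (simp add: T_def A_def \<delta>m_def powr_minus field_simps)
    have sep: "\<delta>m \<le> \<bar>\<Sum>j\<in>UNIV. of_int (q j) * \<beta> $ j\<bar>"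
      if q: "q \<noteq> (\<lambda>_. 0)" "\<forall>j. \<bar>q j\<bar> \<le> 4 * int m + 1" for q :: "'r \<Rightarrow> int"
    proof -
      define p :: "real ^ 'r" where "p = (\<chi> j. of_int (q j))"
      have "p \<noteq> 0" using q(1) by (auto simp: p_def vec_eq_iff fun_eq_iff)
      have "norm p \<le> (\<Sum>j\<in>UNIV. \<bar>p $ j\<bar>)" by (rule norm_le_l1_cart)
      also have "\<dots> \<le> (\<Sum>j\<in>(UNIV :: 'r set). 5 * real m)"
      proof (rule sum_mono)
        fix j
        have "\<bar>q j\<bar> \<le> 5 * int m" using q(2)[rule_format, of j] m by linarith
        then show "\<bar>p $ j\<bar> \<le> 5 * real m" by (simp add: p_def)
      qed
      finally have "norm p \<le> 5 * r * real m" by (simp add: r_def mult_ac)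
      then have "(5 * r * real m) powr - \<tau> \<le> norm p powr - \<tau>"
        using \<open>p \<noteq> 0\<close> \<tau> by (intro powr_mono2') auto
      then have "norm \<beta> * (\<gamma> * (5 * r * real m) powr - \<tau>) \<le> norm \<beta> * (\<gamma> * norm p powr - \<tau>)"
        using \<gamma> by (intro mult_left_mono) auto
      also have "\<dots> \<le> norm \<beta> * \<bar>p \<bullet> (\<beta> /\<^sub>R norm \<beta>)\<bar>"
        using \<open>p \<noteq> 0\<close> by (intro mult_left_mono ge) (auto simp: p_def)
      also have "\<dots> = \<bar>p \<bullet> \<beta>\<bar>" using \<open>\<beta> \<noteq> 0\<close> by (simp add: abs_mult)
      also have "p \<bullet> \<beta> = (\<Sum>j\<in>UNIV. of_int (q j) * \<beta> $ j)" by (simp add: inner_vec_def p_def)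
      finally show ?thesis using r by (simp add: \<delta>m_def \<delta>_def powr_mult mult_ac)
    qed
    \<comment> \<open>Reaching \<open>y - T *\<^sub>R \<beta>\<close> during [0, T] means reaching
      \<open>y\<close> during [T, 2 T].\<close>
    from orbit_hits_box[OF m \<delta>m sep, of "y - T *\<^sub>R \<beta>"] obtain s where s: "0 \<le> s" "s \<le> T"
      "(\<Sum>j\<in>UNIV. (cmod (1 - cis (s * \<beta> $ j - (y - T *\<^sub>R \<beta>) $ j)))\<^sup>2) \<le> 4 * real CARD('r) * 2 ^ CARD('r) / (real m)\<^sup>2"
      unfolding T by blast
    define t where "t = s + T"
    define x where "x = t *\<^sub>R \<beta> - y"
    have "cmod (1 - cis (x $ j)) \<le> c / real m" for j
    proof -
      have "(cmod (1 - cis (x $ j)))\<^sup>2 \<le> (\<Sum>j\<in>UNIV. (cmod (1 - cis (x $ j)))\<^sup>2)"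
        by (intro member_le_sum) auto
      also have "\<dots> \<le> 4 * r * 2 ^ CARD('r) / (real m)\<^sup>2"
        using s(3) by (simp add: x_def t_def r_def algebra_simps)
      also have "\<dots> = (c / real m)\<^sup>2" using r by (simp add: c_def power_divide)
      finally show ?thesis by (rule power2_le_imp_le) (use c in simp)
    qed
    moreover have "c / real m < 1 / 2" using D mD m by (simp add: field_simps)
    ultimately obtain w where w: "tclass w = tclass x" "norm w \<le> 2 * real CARD('r) * (c / real m)"
      using small_representative[of x "c / real m"] by blast
    have "tclass (t *\<^sub>R \<beta> + - w) = tclass (y + x + - w)" by (simp add: x_def)
    also have "\<dots> = tclass (y + w + - w)" by (simp only: tclass_add w(1))
    finally have "tclass (t *\<^sub>R \<beta> + - w) = tclass y" by simp
    moreover have "norm (- w) \<le> D / real m" using w(2) by (simp add: D_def r_def)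
    moreover have "A * real m powr \<tau> \<le> t" "t \<le> 2 * A * real m powr \<tau>"
      using s by (auto simp: t_def T_def)
    ultimately show ?thesis by (intro exI[of _ t] exI[of _ "- w"] conjI)
  qed
  have "0 < A" using \<delta> by (simp add: A_def)
  then show ?thesis
    by (intro exI[of _ A] conjI[OF \<open>0 < A\<close>] exI[of _ D] conjI[OF D(2)] allI impI hit)
qed

section \<open>One-dimensional orbit closures\<close>

text \<open>By compactness the positions at integer times have a convergent subsequence. The
  difference of two late times of it is at least 1 and almost a period.\<close>

lemma flow_recurs:
  fixes l :: "real ^ 'n"
  assumes "0 < \<epsilon>"
  shows "\<exists>t w. 1 \<le> t \<and> tclass w = tclass (t *\<^sub>R l) \<and> norm w < \<epsilon>"
proof -
  define \<eta> where "\<eta> = min (1 / 3) (\<epsilon> / (3 * real CARD('n)))"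
  have \<eta>: "0 < \<eta>" "\<eta> < 1 / 2" "2 * real CARD('n) * \<eta> < \<epsilon>"
  proof -
    show "0 < \<eta>" "\<eta> < 1 / 2" using assms by (auto simp: \<eta>_def)
    have "2 * real CARD('n) * \<eta> \<le> 2 * real CARD('n) * (\<epsilon> / (3 * real CARD('n)))"
      unfolding \<eta>_def by (intro mult_left_mono) auto
    also have "\<dots> < \<epsilon>" using assms by simp
    finally show "2 * real CARD('n) * \<eta> < \<epsilon>" .
  qed
  define z where "z k = tclass (real k *\<^sub>R l)" for k :: nat
  have "\<forall>k. z k \<in> torus" by (simp add: z_def)
  then obtain x r where r: "strict_mono r" "(z \<circ> r) \<longlonglongrightarrow> x"
    by (rule seq_compactE[OF compact_imp_seq_compact[OF compact_torus]])
  from LIMSEQ_imp_Cauchy[OF r(2)] \<eta>(1) obtain k where k: "\<And>m n. k \<le> m \<Longrightarrow> k \<le> n \<Longrightarrow> dist (z (r m)) (z (r n)) < \<eta>"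
    unfolding Cauchy_def by force
  define t where "t = real (r (Suc k)) - real (r k)"
  have "r k < r (Suc k)" using r(1) by (simp add: strict_mono_Suc_iff)
  then have "1 \<le> t" by (simp add: t_def)
  moreover have "cmod (1 - cis ((t *\<^sub>R l) $ j)) \<le> \<eta>" for j
  proof -
    have "z (r (Suc k)) $ j - z (r k) $ j = cis (real (r k) * l $ j) * (cis ((t *\<^sub>R l) $ j) - 1)"
      by (simp add: z_def tclass_def t_def right_diff_distrib cis_mult algebra_simps)
    then have "cmod (1 - cis ((t *\<^sub>R l) $ j)) = cmod ((z (r (Suc k)) - z (r k)) $ j)"
      by (simp add: norm_mult norm_minus_commute)
    also have "\<dots> \<le> dist (z (r (Suc k))) (z (r k))"
      unfolding dist_norm by (rule Finite_Cartesian_Product.norm_nth_le)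
    also have "\<dots> < \<eta>" by (rule k) auto
    finally show ?thesis by simp
  qed
  from small_representative[OF this \<eta>(2)] obtain w where "tclass w = tclass (t *\<^sub>R l)"
      "norm w \<le> 2 * real CARD('n) * \<eta>" by blast
  ultimately show ?thesis using \<eta>(3) by (intro exI[of _ t] exI[of _ w]) auto
qed

text \<open>Only integer multiples of \<open>u n\<close> are known to represent orbit points. Since
  \<open>u n\<close> tends to 0, rounding to such multiples still approximates
  \<open>s *\<^sub>R d\<close> for every real \<open>s\<close>. This makes \<open>d\<close> a
  tangent direction of the closure.\<close>

lemma tclass_limit_direction_in_orbit_closure:
  fixes l d :: "real ^ 'n"
  assumes u: "\<And>n. u n \<noteq> 0" "u \<longlonglongrightarrow> 0" and d: "(\<lambda>n. u n /\<^sub>R norm (u n)) \<longlonglongrightarrow> d"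
    and eq: "\<And>n. tclass (u n) = tclass (T n *\<^sub>R l)"
  shows "tclass (s *\<^sub>R d) \<in> orbit_closure l"
proof -
  define m where "m n = \<lfloor>s / norm (u n)\<rfloor>" for n
  have "(\<lambda>n. of_int (m n) * norm (u n) - s) \<longlonglongrightarrow> 0"
  proof (rule Lim_null_comparison)
    show "\<forall>\<^sub>F n in sequentially. norm (of_int (m n) * norm (u n) - s) \<le> norm (u n)"
    proof (intro always_eventually allI)
      fix n
      have pos: "0 < norm (u n)" using u(1) by simp
      have "\<bar>of_int (m n) - s / norm (u n)\<bar> \<le> 1" unfolding m_def by linarith
      then have "\<bar>of_int (m n) - s / norm (u n)\<bar> * norm (u n) \<le> 1 * norm (u n)"
        by (rule mult_right_mono) simp
      moreover have "\<bar>of_int (m n) - s / norm (u n)\<bar> * norm (u n) = \<bar>of_int (m n) * norm (u n) - s\<bar>"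
      proof -
        have "of_int (m n) * norm (u n) - s = (of_int (m n) - s / norm (u n)) * norm (u n)"
          using pos by (simp add: field_simps)
        then show ?thesis by (simp add: abs_mult)
      qed
      ultimately show "norm (of_int (m n) * norm (u n) - s) \<le> norm (u n)" by simp
    qed
    show "(\<lambda>n. norm (u n)) \<longlonglongrightarrow> 0" using u(2) by (rule tendsto_norm_zero)
  qed
  then have "(\<lambda>n. of_int (m n) * norm (u n)) \<longlonglongrightarrow> s" by (simp add: LIM_zero_iff)
  from tendsto_scaleR[OF this d]
  have "(\<lambda>n. (of_int (m n) * norm (u n)) *\<^sub>R (u n /\<^sub>R norm (u n))) \<longlonglongrightarrow> s *\<^sub>R d" .
  moreover have "(of_int (m n) * norm (u n)) *\<^sub>R (u n /\<^sub>R norm (u n)) = of_int (m n) *\<^sub>R u n" for n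
    using u(1)[of n] by (simp add: mult.assoc)
  ultimately have "(\<lambda>n. of_int (m n) *\<^sub>R u n) \<longlonglongrightarrow> s *\<^sub>R d"
    by (simp only:)
  moreover have "isCont tclass (s *\<^sub>R d)"
    using continuous_on_tclass[OF continuous_on_id, of "UNIV :: (real ^ 'n) set"] by (simp add: continuous_on_eq_continuous_at)
  ultimately have "(\<lambda>n. tclass (of_int (m n) *\<^sub>R u n)) \<longlonglongrightarrow> tclass (s *\<^sub>R d)"
    by (intro isCont_tendsto_compose[of _ tclass])
  moreover have "tclass (of_int (m n) *\<^sub>R u n) \<in> orbit_closure l" for n
    using tclass_in_orbit_closure[of "of_int (m n) * T n" l]
    unfolding tclass_scaleR_of_int[OF eq] scaleR_scaleR .
  ultimately show ?thesis
    unfolding orbit_closure_def by (rule closed_sequentially[OF closed_closure, rotated])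
qed

text \<open>A nonperiodic flow returns to the identity with arbitrarily small displacements orthogonal to
  \<open>l\<close>. A limit of their directions is a second tangent direction of the orbit closure.\<close>

lemma flow_periodic_if_dim_1:
  fixes l :: "real ^ 'n"
  assumes dim: "torus_dim (orbit_closure l) = 1" and l: "l \<noteq> 0"
  shows "\<exists>T>0. tclass (T *\<^sub>R l) = 1"
proof (rule ccontr)
  assume no: "\<not> ?thesis"
  have "\<exists>u T. tclass u = tclass (T *\<^sub>R l) \<and> u \<noteq> 0 \<and> u \<bullet> l = 0 \<and> norm u < 1 / real (Suc n)" for n
  proof -
    \<comment> \<open>The bound by \<open>norm l / 2\<close> forces |c| < 1 \<le> t, hence a
      positive corrected time t - c. The 2 in the other bound pays for removing the component along
      \<open>l\<close>, estimated by doubling the norm.\<close>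
    define \<epsilon> where "\<epsilon> = min (1 / (2 * real (Suc n))) (norm l / 2)"
    have "0 < \<epsilon>" using l by (simp add: \<epsilon>_def)
    from flow_recurs[OF this, of l] obtain t w where tw: "1 \<le> t" "tclass w = tclass (t *\<^sub>R l)" "norm w < \<epsilon>"
      by blast
    \<comment> \<open>Removing the component along \<open>l\<close> only changes the return time by
      \<open>c\<close>, so \<open>u\<close> still represents an orbit point; if it vanished, t - c
      would be a period.\<close>
    define c where "c = (w \<bullet> l) / (l \<bullet> l)"
    define u where "u = w - c *\<^sub>R l"
    have "\<bar>w \<bullet> l\<bar> \<le> norm w * norm l" by (rule Cauchy_Schwarz_ineq2)
    then have cl: "\<bar>c\<bar> * norm l \<le> norm w"
      using l by (simp add: c_def abs_divide dot_square_norm power2_eq_square divide_le_eq)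
    moreover have "norm w < 1 * norm l"
    proof -
      have "\<epsilon> \<le> norm l / 2" by (simp add: \<epsilon>_def)
      with tw(3) show ?thesis using norm_ge_zero[of l] by linarith
    qed
    ultimately have "\<bar>c\<bar> * norm l < 1 * norm l" by (rule le_less_trans)
    then have "\<bar>c\<bar> < 1" by (rule mult_right_less_imp_less) simp
    then have T: "0 < t - c" using tw(1) by linarith
    have "u = w + (- c) *\<^sub>R l" by (simp add: u_def)
    then have "tclass u = tclass (t *\<^sub>R l) * tclass ((- c) *\<^sub>R l)" by (simp only: tclass_add tw(2))
    also have "\<dots> = tclass ((t - c) *\<^sub>R l)" by (simp add: tclass_add[symmetric] algebra_simps)
    finally have tu: "tclass u = tclass ((t - c) *\<^sub>R l)" .
    moreover have "u \<noteq> 0"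
    proof
      assume "u = 0"
      with tu have "tclass ((t - c) *\<^sub>R l) = 1" by simp
      with T no show False by blast
    qed
    moreover have "u \<bullet> l = 0" using l by (simp add: u_def c_def inner_diff_left)
    moreover have "norm u < 1 / real (Suc n)"
    proof -
      have "norm u \<le> norm w + \<bar>c\<bar> * norm l" unfolding u_def
        by (rule order_trans[OF norm_triangle_ineq4]) simp
      also have "\<dots> < 2 * \<epsilon>" using cl tw(3) by linarith
      also have "\<dots> \<le> 1 / real (Suc n)" by (simp add: \<epsilon>_def min_def field_simps)
      finally show ?thesis .
    qed
    ultimately show ?thesis by blast
  qed
  then obtain u where "\<And>n. \<exists>T. tclass (u n) = tclass (T *\<^sub>R l) \<and> u n \<noteq> 0 \<and> u n \<bullet> l = 0 \<and> norm (u n) < 1 / real (Suc n)"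
    by metis
  then have u: "\<exists>T. tclass (u n) = tclass (T *\<^sub>R l)" "u n \<noteq> 0" "u n \<bullet> l = 0" "norm (u n) < 1 / real (Suc n)" for n
    by blast+
  from u(1) obtain T where T: "\<And>n. tclass (u n) = tclass (T n *\<^sub>R l)" by metis
  have u0: "u \<longlonglongrightarrow> 0"
    using u(4) by (intro Lim_null_comparison[OF _ LIMSEQ_Suc[OF lim_1_over_n]]) (auto intro!: always_eventually less_imp_le)
  have "\<forall>n. u n /\<^sub>R norm (u n) \<in> sphere 0 1" using u(2) by simp
  then obtain d r where d: "d \<in> sphere 0 1" "strict_mono r" "((\<lambda>n. u n /\<^sub>R norm (u n)) \<circ> r) \<longlonglongrightarrow> d"
    by (rule seq_compactE[OF compact_imp_seq_compact[OF compact_sphere]])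
  have "tclass (s *\<^sub>R d) \<in> orbit_closure l" for s
  proof (rule tclass_limit_direction_in_orbit_closure[of "u \<circ> r" d "T \<circ> r"])
    show "(u \<circ> r) \<longlonglongrightarrow> 0" using u0 d(2) by (rule LIMSEQ_subseq_LIMSEQ)
    show "(\<lambda>n. (u \<circ> r) n /\<^sub>R norm ((u \<circ> r) n)) \<longlonglongrightarrow> d" using d(3) by (simp add: o_def)
  qed (use u(2) T in auto)
  then have dL: "d \<in> torus_lie_algebra (orbit_closure l)" by (simp add: torus_lie_algebra_def)
  have lL: "l \<in> torus_lie_algebra (orbit_closure l)"
    by (simp add: torus_lie_algebra_def tclass_in_orbit_closure)
  have "d \<bullet> l = 0"
  proof (rule LIMSEQ_unique)
    show "(\<lambda>n. ((\<lambda>n. u n /\<^sub>R norm (u n)) \<circ> r) n \<bullet> l) \<longlonglongrightarrow> d \<bullet> l"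
      by (intro tendsto_inner d tendsto_const)
    show "(\<lambda>n. ((\<lambda>n. u n /\<^sub>R norm (u n)) \<circ> r) n \<bullet> l) \<longlonglongrightarrow> 0"
      using u(3) by simp
  qed
  moreover have "d \<noteq> 0" using d(1) by auto
  ultimately have "d \<noteq> l" and "pairwise orthogonal {d, l}" and "0 \<notin> {d, l}"
    using l by (auto simp: pairwise_def orthogonal_def inner_commute)
  from pairwise_orthogonal_independent[OF this(2,3)]
  have "card {d, l} \<le> dim (torus_lie_algebra (orbit_closure l))"
    using dL lL by (intro independent_card_le_dim) auto
  with dim \<open>d \<noteq> l\<close> show False by (simp add: torus_dim_def)
qed

text \<open>Reduction modulo \<open>T\<close> exhibits the orbit as a continuous image of the
  compact interval [0, T], so it is already closed.\<close>

lemma periodic_orbit_closure: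
  assumes T: "0 < T" "tclass (T *\<^sub>R l) = 1"
  shows "orbit_closure l = range (\<lambda>t. tclass (t *\<^sub>R l))"
    and "tclass ((t + of_int n * T) *\<^sub>R l) = tclass (t *\<^sub>R l)"
proof -
  show per: "tclass ((t + of_int n * T) *\<^sub>R l) = tclass (t *\<^sub>R l)" for t n
    using tclass_scaleR_of_int[of "T *\<^sub>R l" 0 n] T(2) by (simp add: scaleR_left_distrib tclass_add)
  have "range (\<lambda>t. tclass (t *\<^sub>R l)) = (\<lambda>t. tclass (t *\<^sub>R l)) ` {0..T}"
  proof (intro subset_antisym subsetI)
    fix x assume "x \<in> range (\<lambda>t. tclass (t *\<^sub>R l))"
    then obtain t where x: "x = tclass (t *\<^sub>R l)" by blast
    let ?s = "t + of_int (- \<lfloor>t / T\<rfloor>) * T"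
    have "of_int \<lfloor>t / T\<rfloor> * T \<le> t / T * T" "t / T * T \<le> (of_int \<lfloor>t / T\<rfloor> + 1) * T"
      using T(1) by (intro mult_right_mono; linarith)+
    then have "?s \<in> {0..T}" using T(1) by (auto simp: algebra_simps)
    then show "x \<in> (\<lambda>t. tclass (t *\<^sub>R l)) ` {0..T}" using per[of t "- \<lfloor>t / T\<rfloor>"] x by (metis imageI)
  qed auto
  moreover have "compact ((\<lambda>t. tclass (t *\<^sub>R l)) ` {0..T})"
    by (intro compact_continuous_image continuous_intros) auto
  ultimately show "orbit_closure l = range (\<lambda>t. tclass (t *\<^sub>R l))"
    by (simp add: orbit_closure_def compact_imp_closed)
qed

section \<open>Simple eigenvalues and the secular determinant\<close>

lemma det_eq_0_iff_kernel:
  fixes A :: "'a::field ^ 'n ^ 'n"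
  shows "det A = 0 \<longleftrightarrow> (\<exists>v. v \<noteq> 0 \<and> A *v v = 0)"
  by (metis invertible_det_nz invertible_left_inverse matrix_left_invertible_ker)

lemma tendsto_det:
  fixes f :: "'x \<Rightarrow> 'n::finite \<Rightarrow> 'n \<Rightarrow> 'a::{comm_ring_1, real_normed_algebra_1}"
  assumes "\<And>i j. ((\<lambda>x. f x i j) \<longlongrightarrow> g i j) F"
  shows "((\<lambda>x. det (\<chi> i j. f x i j)) \<longlongrightarrow> det (\<chi> i j. g i j)) F"
  unfolding det_def using assms by (auto intro!: tendsto_intros)

lemma mat_mult_vec: "mat x *v v = x *s v" for x :: "'a::semiring_1"
  by (simp add: mat_def matrix_vector_mult_def vec_eq_iff if_distrib[of "\<lambda>y. y * _"] sum.delta cong: if_cong)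

text \<open>Homogeneity in one column, for determinants of the shape that
  \<open>cramer_lemma\<close> produces; transposition reduces it to a row.\<close>

lemma det_replace_column_scale:
  fixes M :: "'a::comm_ring_1 ^ 'n ^ 'n"
  shows "det (\<chi> k l. if l = m then (c *s v) $ k else M $ k $ l)
    = c * det (\<chi> k l. if l = m then v $ k else M $ k $ l)"
proof -
  have T: "transpose (\<chi> k l. if l = m then w $ k else M $ k $ l) = (\<chi> l. if l = m then w else column l M)"
    for w :: "'a ^ 'n" by (auto simp: transpose_def vec_eq_iff column_def)
  show ?thesis
    by (subst (1 2) det_transpose[symmetric], unfold T, rule det_row_mul)
qed

lemma poly_charpoly: "poly (charpoly U) x = det (mat x - U)"
  by (simp add: charpoly_def det_def poly_sum poly_prod mat_def if_distrib[of "\<lambda>p. poly p _"] cong: if_cong)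

text \<open>If det (x - U) vanished identically, so would det (1 - y U) for y \<noteq> 0, and
  letting y tend to 0 would give det 1 = 0. This lets \<open>order_decomp\<close> turn
  \<open>order\<close> into an exact factorisation.\<close>

lemma charpoly_nonzero: "charpoly U \<noteq> 0" for U :: "complex ^ 'n ^ 'n"
proof
  assume "charpoly U = 0"
  then have 0: "det (mat x - U) = 0" for x using poly_charpoly[of U x] by simp
  have "det (\<chi> i j. mat 1 $ i $ j - y * U $ i $ j) = 0" if "y \<noteq> 0" for y
  proof -
    from 0[of "1 / y"] obtain v where v: "v \<noteq> 0" "(mat (1 / y) - U) *v v = 0"
      using det_eq_0_iff_kernel by blast
    then have "(1 / y) *s v = U *v v" by (simp add: matrix_vector_mult_diff_rdistrib mat_mult_vec)
    then have "y *s (U *v v) = v" using that by (metis divide_self_if mult.commute times_divide_eq_left vector_smult_assoc mult_1 vector_smult_lid)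
    moreover have "(\<chi> i j. y * U $ i $ j) *v v = y *s (U *v v)"
      by (simp add: vec_eq_iff matrix_vector_mult_def sum_distrib_left mult.assoc)
    ultimately have "(mat 1 - (\<chi> i j. y * U $ i $ j)) *v v = 0"
      by (simp add: matrix_vector_mult_diff_rdistrib)
    moreover have "mat 1 - (\<chi> i j. y * U $ i $ j) = (\<chi> i j. mat 1 $ i $ j - y * U $ i $ j)"
      by (simp add: vec_eq_iff)
    ultimately show ?thesis using v(1) det_eq_0_iff_kernel by metis
  qed
  then have "\<forall>\<^sub>F y in at 0. det (\<chi> i j. mat 1 $ i $ j - y * U $ i $ j) = 0"
    by (auto simp: eventually_at_filter)
  moreover have "((\<lambda>y. det (\<chi> i j. mat 1 $ i $ j - y * U $ i $ j)) \<longlongrightarrow>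
      det (\<chi> i j. mat 1 $ i $ j - 0 * U $ i $ j)) (at 0)"
    by (intro tendsto_det tendsto_intros)
  ultimately have "det (\<chi> i j. (mat 1 :: complex ^ 'n ^ 'n) $ i $ j - 0 * U $ i $ j) = 0"
    by (intro tendsto_unique[OF trivial_limit_at _ tendsto_eventually])
  moreover have "(\<chi> i j. (mat 1 :: complex ^ 'n ^ 'n) $ i $ j - 0 * U $ i $ j) = mat 1"
    by (simp add: vec_eq_iff)
  ultimately show False by simp
qed

text \<open>A second eigenvector \<open>b\<close> would let Cramer's rule pull two factors \<open>x - 1\<close> out of \<open>det (x - U)\<close>.\<close>

lemma geometric_multiplicity_simple_eigenvalue:
  fixes U :: "complex ^ 'n ^ 'n"
  assumes simple: "simple_eigenvalue U 1" and a: "U *v a = a" "a $ i \<noteq> 0"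
    and b: "U *v b = b" "b $ i = 0"
  shows "b = 0"
proof (rule ccontr)
  assume "b \<noteq> 0"
  then obtain j where j: "b $ j \<noteq> 0" by (auto simp: vec_eq_iff)
  with b have ij: "i \<noteq> j" by auto
  define A where "A x = mat x - U" for x
  \<comment> \<open>Because \<open>b $ i = 0\<close>, replacing column \<open>i\<close> does not
    affect the product with \<open>b\<close>, so Cramer's rule applies a second time.\<close>
  define N where "N x = (\<chi> k l. if l = i then a $ k else A x $ k $ l)" for x
  define g where "g x = det (\<chi> k l. if l = j then b $ k else N x $ k $ l)" for x
  have Aa: "A x *v a = (x - 1) *s a" and Ab: "A x *v b = (x - 1) *s b" for x
    using a b by (simp_all add: A_def matrix_vector_mult_diff_rdistrib mat_mult_vec vector_sub_rdistrib)
  have Nb: "N x *v b = (x - 1) *s b" for x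
  proof -
    have "N x *v b = A x *v b"
      using b(2) by (auto simp: N_def matrix_vector_mult_def vec_eq_iff intro!: sum.cong)
    with Ab show ?thesis by simp
  qed
  have "a $ i * det (A x) = (x - 1) * det (N x)" for x
    using cramer_lemma[of i "A x" a, symmetric] unfolding Aa det_replace_column_scale N_def .
  moreover have "b $ j * det (N x) = (x - 1) * g x" for x
    using cramer_lemma[of j "N x" b, symmetric] unfolding Nb det_replace_column_scale g_def .
  ultimately have dA: "a $ i * b $ j * det (A x) = (x - 1)\<^sup>2 * g x" for x
    by (metis (no_types, lifting) mult.assoc mult.left_commute power2_eq_square)
  have ord: "order 1 (charpoly U) = 1" using simple by (simp add: simple_eigenvalue_def)
  from order_decomp[OF charpoly_nonzero[of U], of 1] ord obtain r where r: "charpoly U = [:- 1, 1:] * r" "\<not> [:- 1, 1:] dvd r"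
    by auto
  have r1: "poly r 1 \<noteq> 0" using r(2) by (simp add: poly_eq_0_iff_dvd)
  have eq: "a $ i * b $ j * poly r x = (x - 1) * g x" if "x \<noteq> 1" for x
  proof -
    have "det (A x) = (x - 1) * poly r x"
      using poly_charpoly[of U x] r(1) by (simp add: A_def algebra_simps)
    then have "(x - 1) * (a $ i * b $ j * poly r x) = (x - 1) * ((x - 1) * g x)"
      using dA[of x] by (simp add: power2_eq_square mult_ac)
    with that show ?thesis by simp
  qed
  \<comment> \<open>The factor x - 1 can be cancelled only away from 1; continuity of
    \<open>g\<close> transports the identity to 1, where it forces
    \<open>poly r 1 = 0\<close>.\<close>
  have "(g \<longlongrightarrow> g 1) (at 1)"
    unfolding g_def by (rule tendsto_det) (auto simp: N_def A_def mat_def intro!: tendsto_intros)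
  then have "((\<lambda>x. (x - 1) * g x) \<longlongrightarrow> (1 - 1) * g 1) (at 1)"
    by (intro tendsto_intros)
  moreover have "((\<lambda>x. a $ i * b $ j * poly r x) \<longlongrightarrow> a $ i * b $ j * poly r 1) (at 1)"
    by (intro tendsto_intros)
  moreover have "\<forall>\<^sub>F x in at 1. a $ i * b $ j * poly r x = (x - 1) * g x"
    using eq by (auto simp: eventually_at_filter)
  then have "((\<lambda>x. (x - 1) * g x) \<longlongrightarrow> a $ i * b $ j * poly r 1) (at 1)"
    using calculation(2) by (rule Lim_transform_eventually[rotated])
  with calculation(1) have "(1 - 1) * g 1 = a $ i * b $ j * poly r 1"
    by (intro tendsto_unique[OF trivial_limit_at])
  with a(2) j r1 show False by simp
qed

section \<open>Unitarity and the phase of the secular determinant\<close>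

abbreviation adj :: "complex ^ 'n ^ 'm \<Rightarrow> complex ^ 'm ^ 'n" where
  "adj A \<equiv> map_matrix cnj (transpose A)"

text \<open>Once incoming bonds are reversed, rows and columns at a vertex are both indexed by its
  outgoing bonds, a loop counting twice as in \<open>vdegree\<close>. At an interior vertex of
  degree d the block is (2/d) J - 1 with J the all-ones matrix, and J^2 = d J makes it a real
  symmetric involution. An exterior vertex has a single entry 1 or -1.\<close>

lemma S_B_adjoint_inverse:
  fixes G :: "('v, 'e::finite) multigraph"
  shows "S_B G bc ** adj (S_B G bc) = mat 1"
proof -
  let ?s = "S_B G bc"
  have cnj: "cnj (?s $ b $ c) = ?s $ b $ c" for b c
    by (simp add: S_B_def scattering_def Let_def split: boundary_cond.split)
  have inv: "bij (bond_rev :: 'e bond \<Rightarrow> _)"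
    by (rule o_bij[of bond_rev]) (auto simp: bond_rev_def)
  have rr: "bond_rev (bond_rev b) = b" for b :: "'e bond" by (simp add: bond_rev_def)
  have "(\<Sum>d\<in>UNIV. ?s $ b $ d * ?s $ c $ d) = (if b = c then 1 else 0)" for b c
  proof -
    define V where "V = {d. bond_init G d = bond_init G b}"
    have bV: "b \<in> V" by (simp add: V_def)
    have cardV: "card V = vdegree G (bond_init G b)" by (simp add: V_def vdegree_def)
    have "(\<Sum>d\<in>UNIV. ?s $ b $ d * ?s $ c $ d) = (\<Sum>d\<in>UNIV. ?s $ b $ bond_rev d * ?s $ c $ bond_rev d)"
      by (rule sum.reindex_bij_betw[OF inv, symmetric])
    also have "\<dots> = (\<Sum>d\<in>V. ?s $ b $ bond_rev d * ?s $ c $ bond_rev d)"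
      by (rule sum.mono_neutral_right) (auto simp: V_def S_B_def bond_term_def rr)
    also have "\<dots> = (if b = c then 1 else 0)"
    proof (cases "bond_init G c = bond_init G b")
      case False
      then show ?thesis by (auto simp: S_B_def bond_term_def rr V_def intro!: sum.neutral)
    next
      case cV: True
      show ?thesis
      proof (cases "exterior G (bond_init G b)")
        case True
        then have "card V = 1" by (simp add: exterior_def cardV)
        then obtain z where "V = {z}" by (rule card_1_singletonE)
        with bV have V: "V = {b}" by auto
        moreover have "c \<in> V" using cV by (simp add: V_def)
        ultimately have "c = b" by auto
        with V True show ?thesis
          by (simp add: S_B_def bond_term_def rr scattering_def Let_def split: boundary_cond.split)
      next
        case False
        define k :: complex where "k = of_nat (card V)"
        have "card V \<noteq> 0" using bV by (auto simp: card_eq_0_iff)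
        then have k: "k \<noteq> 0" by (simp add: k_def)
        have entry: "?s $ x $ bond_rev d = 2 / k - (if d = x then 1 else 0)" if "d \<in> V" "x \<in> V" for x d
          using that False by (auto simp: V_def S_B_def bond_term_def rr scattering_def Let_def k_def
            vdegree_def bond_rev_def prod_eq_iff)
        have "(\<Sum>d\<in>V. ?s $ b $ bond_rev d * ?s $ c $ bond_rev d) =
            (\<Sum>d\<in>V. 4 / k\<^sup>2 - (if d = b then 2 / k else 0) - (if d = c then 2 / k else 0)
              + (if d = b then if b = c then 1 else 0 else 0))"
          using bV cV by (intro sum.cong refl)
            (auto simp: entry V_def algebra_simps power2_eq_square)
        also have "\<dots> = k * (4 / k\<^sup>2) - 2 / k - 2 / k + (if b = c then 1 else 0)"
          using bV cV by (simp add: sum.distrib sum_subtractf k_def V_def)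
        also have "\<dots> = (if b = c then 1 else 0)"
          using k by (simp add: power2_eq_square field_simps)
        finally show ?thesis .
      qed
    qed
    finally show ?thesis .
  qed
  then show ?thesis
    by (simp add: matrix_matrix_mult_def map_matrix_def transpose_def mat_def vec_eq_iff cnj)
qed

lemma det_map_cnj: "det (map_matrix cnj A) = cnj (det A)"
  by (simp add: det_def map_matrix_def)

lemma D_B_mult: "D_B \<theta> ** D_B \<eta> = D_B (\<theta> * \<eta>)"
  by (simp add: D_B_def matrix_matrix_mult_def vec_eq_iff if_distrib[of "\<lambda>y. y * _"] sum.delta cong: if_cong)

lemma det_D_B: "det (D_B \<theta>) = (\<Prod>e\<in>UNIV. (\<theta> $ e)\<^sup>2)" for \<theta> :: "complex ^ 'e::finite"
proof -
  have "det (D_B \<theta>) = (\<Prod>b\<in>(UNIV :: ('e \<times> bool) set). \<theta> $ fst b)"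
    by (subst det_diagonal) (auto simp: D_B_def)
  also have "\<dots> = (\<Prod>e\<in>UNIV. \<Prod>s\<in>(UNIV::bool set). \<theta> $ e)"
    unfolding prod.cartesian_product UNIV_Times_UNIV split_def by (rule refl)
  finally show ?thesis by (simp add: card_UNIV_bool)
qed


lemma adj_mult: "adj (A ** B) = adj B ** adj A"
  by (simp add: matrix_matrix_mult_def map_matrix_def transpose_def vec_eq_iff mult.commute)

lemma det_adj: "det (adj A) = cnj (det A)"
  by (simp add: det_map_cnj)

lemma adj_D_B: "adj (D_B \<theta>) = D_B (\<chi> e. cnj (\<theta> $ e))"
  by (auto simp: D_B_def map_matrix_def transpose_def vec_eq_iff)

lemma U_B_unitary:
  assumes "\<theta> \<in> torus"
  shows "U_B G bc \<theta> ** adj (U_B G bc \<theta>) = mat 1"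
proof -
  have "U_B G bc \<theta> ** adj (U_B G bc \<theta>) = D_B \<theta> ** (S_B G bc ** adj (S_B G bc)) ** adj (D_B \<theta>)"
    by (simp add: U_B_def adj_mult matrix_mul_assoc)
  also have "\<dots> = D_B (\<theta> * (\<chi> e. cnj (\<theta> $ e)))"
    by (simp add: S_B_adjoint_inverse matrix_mul_rid adj_D_B D_B_mult)
  also have "\<theta> * (\<chi> e. cnj (\<theta> $ e)) = 1"
    using assms by (simp add: torus_def vec_eq_iff flip: complex_norm_square)
  also have "D_B 1 = mat 1" by (simp add: D_B_def mat_def vec_eq_iff)
  finally show ?thesis .
qed

text \<open>No sign appears because the number of bonds is even.\<close>

lemma cnj_secular:
  fixes \<theta> :: "complex ^ 'b::finite"
  assumes "\<theta> \<in> torus"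
  shows "cnj (det (mat 1 - U_B G bc \<theta>)) = cnj (det (U_B G bc \<theta>)) * det (mat 1 - U_B G bc \<theta>)"
proof -
  let ?U = "U_B G bc \<theta>"
  have "adj (mat 1 - ?U) = mat 1 - adj ?U"
    by (auto simp: map_matrix_def transpose_def vec_eq_iff mat_def)
  moreover have "adj ?U ** ?U = mat 1"
    using U_B_unitary[OF assms, of G bc] by (simp add: matrix_left_right_inverse)
  moreover have mult_diff: "A ** (B - C) = A ** B - A ** C" for A B C :: "complex ^ 'b bond ^ 'b bond"
    by (simp add: matrix_matrix_mult_def vec_eq_iff right_diff_distrib sum_subtractf)
  ultimately have "adj (mat 1 - ?U) = adj ?U ** (?U - mat 1)"
    using mult_diff[of "adj ?U" ?U "mat 1"] by simp
  \<comment> \<open>Writing the sign change as a diagonal \<open>D_B\<close> makes its determinant a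
    product of squares, hence 1.\<close>
  also have "?U - mat 1 = D_B (\<chi> e. - 1) ** (mat 1 - ?U)"
    by (simp add: D_B_def matrix_matrix_mult_def vec_eq_iff if_distrib[of "\<lambda>y. y * _"] sum.delta cong: if_cong)
  finally have "det (adj (mat 1 - ?U)) = det (adj ?U) * (det (D_B (\<chi> e :: 'b. - 1)) * det (mat 1 - ?U))"
    by (simp only: det_mul)
  then show ?thesis by (simp add: det_adj det_D_B)
qed

lemma U_B_entry: "U_B G bc \<theta> $ b $ c = \<theta> $ fst b * S_B G bc $ b $ c"
  by (simp add: U_B_def D_B_def matrix_matrix_mult_def if_distrib[of "\<lambda>y. y * _"] sum.delta cong: if_cong)

lemma has_derivative_cis_compose:
  assumes "(f has_derivative f') (at x within A)"
  shows "((\<lambda>v. cis (f v)) has_derivative (\<lambda>y. \<i> * of_real (f' y) * cis (f x))) (at x within A)"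
proof -
  have "((\<lambda>v. \<i> * complex_of_real (f v)) has_derivative (\<lambda>y. \<i> * of_real (f' y))) (at x within A)"
    using assms by (intro has_derivative_mult_right has_derivative_of_real)
  from has_derivative_compose[OF this DERIV_exp[unfolded has_field_derivative_def]] show ?thesis
    by (simp add: cis_conv_exp mult_ac)
qed

lemma secular_differentiable:
  "(\<lambda>v. det (mat 1 - U_B G bc (\<theta> * tclass v))) differentiable (at x)"
proof -
  have "det (mat 1 - U_B G bc (\<theta> * tclass v)) =
      (\<Sum>p | p permutes UNIV. of_int (sign p) * (\<Prod>b\<in>UNIV. mat 1 $ b $ p b
        - \<theta> $ fst b * cis (v $ fst b) * S_B G bc $ b $ p b))" for v
    by (simp add: det_def U_B_entry tclass_def)
  moreover have "\<exists>D. ((\<lambda>v. mat 1 $ b $ c - \<theta> $ fst b * cis (v $ fst b) * S_B G bc $ b $ c)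
      has_derivative D) (at x)" for b c
    by (rule exI, (rule has_derivative_cis_compose derivative_eq_intros refl bounded_linear.has_derivative[OF bounded_linear_vec_nth])+)
  then obtain D where D: "\<And>b c. ((\<lambda>v. mat 1 $ b $ c - \<theta> $ fst b * cis (v $ fst b) * S_B G bc $ b $ c)
      has_derivative D b c) (at x)"
    by metis
  ultimately show ?thesis
    unfolding differentiable_def
    by (simp only:) (rule exI, rule has_derivative_sum, rule has_derivative_mult_right,
      rule has_derivative_prod, rule D)
qed

section \<open>Transversal crossing of the secular set\<close>

text \<open>A unitary matrix and its adjoint fix the same vectors. This is the orthogonality of
  \<open>a\<close> to the range of 1 - U in coordinates.\<close>

lemma U_B_fixed_left:
  assumes "\<theta> \<in> torus" "U_B G bc \<theta> *v a = a"
  shows "(\<Sum>b\<in>UNIV. cnj (a $ b) * U_B G bc \<theta> $ b $ c) = cnj (a $ c)"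
proof -
  let ?U = "U_B G bc \<theta>"
  have "adj ?U ** ?U = mat 1"
    using U_B_unitary[OF assms(1), of G bc] by (simp add: matrix_left_right_inverse)
  then have "adj ?U *v (?U *v a) = a" by (simp add: matrix_vector_mul_assoc)
  then have "(adj ?U *v a) $ c = a $ c" by (simp add: assms(2))
  then have "cnj ((adj ?U *v a) $ c) = cnj (a $ c)" by simp
  then show ?thesis
    by (simp add: matrix_vector_mult_def map_matrix_def transpose_def mult.commute)
qed

text \<open>By Cramer's rule, \<open>a $ i * det (1 - W s)\<close> is the determinant with column \<open>i\<close> replaced by
  \<open>(1 - W s) a\<close>, which is of first order in \<open>s\<close>. The limit of the quotient by \<open>s\<close> is nonzero since the
  range of \<open>1 - U\<close> is orthogonal to \<open>a\<close>, whereas \<open>\<langle>a, L a\<rangle> > 0\<close> for the diagonal matrix \<open>L\<close> of edge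
  lengths.\<close>

lemma secular_derivative_along_flow:
  fixes G :: "('v, 'e::finite) multigraph"
  assumes \<theta>: "\<theta> \<in> torus" and simple: "simple_eigenvalue (U_B G bc \<theta>) 1"
    and a: "U_B G bc \<theta> *v a = a" "a \<noteq> 0" and l: "\<forall>e. 0 < l $ e"
  shows "\<exists>c. c \<noteq> 0 \<and>
    ((\<lambda>s. det (mat 1 - U_B G bc (\<theta> * tclass (s *\<^sub>R l))) / of_real s) \<longlongrightarrow> c) (at (0::real))"
proof -
  let ?W = "\<lambda>s. U_B G bc (\<theta> * tclass (s *\<^sub>R l))" and ?U = "U_B G bc \<theta>"
  obtain i where i: "a $ i \<noteq> 0" using a(2) by (auto simp: vec_eq_iff)
  define r where "r s b = (1 - cis (s * l $ fst b)) / of_real s" for s and b :: "'e bond"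
  \<comment> \<open>Limit as s tends to 0 of the matrices with replaced column: that column becomes
    -\<i> L a, the derivative of (1 - W s) a at s = 0.\<close>
  define M where "M = (\<chi> k m. if m = i then - \<i> * of_real (l $ fst k) * a $ k else mat 1 $ k $ m - ?U $ k $ m)"
  have W: "?W s $ b $ c = cis (s * l $ fst b) * ?U $ b $ c" for s b c
    by (simp add: U_B_entry tclass_def)
  have Wa: "(mat 1 - ?W s) *v a = of_real s *s (\<chi> b. r s b * a $ b)" if "s \<noteq> 0" for s
  proof -
    have "(?W s *v a) $ b = cis (s * l $ fst b) * (?U *v a) $ b" for b
      by (simp add: matrix_vector_mult_def W sum_distrib_left mult.assoc)
    then show ?thesis using that a(1)
      by (simp add: matrix_vector_mult_diff_rdistrib vec_eq_iff r_def field_simps)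
  qed
  have "det (mat 1 - ?W s) / of_real s = det (\<chi> k m. if m = i then (\<chi> b. r s b * a $ b) $ k
      else mat 1 $ k $ m - ?W s $ k $ m) / a $ i" if "s \<noteq> 0" for s
    using cramer_lemma[of i "mat 1 - ?W s" a] that i
    unfolding Wa[OF that] det_replace_column_scale unfolding vector_minus_component by (simp add: field_simps)
  then have ev: "\<forall>\<^sub>F s in at 0. det (\<chi> k m. if m = i then (\<chi> b. r s b * a $ b) $ k
      else mat 1 $ k $ m - ?W s $ k $ m) / a $ i = det (mat 1 - ?W s) / of_real s"
    by (auto simp: eventually_at_filter)
  have r: "((\<lambda>s. r s b) \<longlongrightarrow> - \<i> * of_real (l $ fst b)) (at 0)" for b
  proof -
    have "((\<lambda>z. exp (\<i> * of_real (l $ fst b) * z)) has_field_derivative \<i> * of_real (l $ fst b)) (at 0)"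
      by (auto intro!: derivative_eq_intros)
    then have "((\<lambda>z. (exp (\<i> * of_real (l $ fst b) * z) - 1) / z) \<longlongrightarrow> \<i> * of_real (l $ fst b)) (at 0)"
      by (simp add: DERIV_def)
    moreover have "filterlim complex_of_real (at 0) (at 0)"
      by (auto simp: filterlim_at eventually_at_filter intro!: tendsto_eq_intros)
    ultimately have "((\<lambda>s. (exp (\<i> * of_real (l $ fst b) * of_real s) - 1) / of_real s) \<longlongrightarrow>
        \<i> * of_real (l $ fst b)) (at 0)"
      by (rule filterlim_compose)
    from tendsto_minus[OF this] show ?thesis
      by (simp add: r_def cis_conv_exp mult_ac minus_divide_left)
  qed
  have "((\<lambda>s. det (\<chi> k m. if m = i then (\<chi> b. r s b * a $ b) $ k
      else mat 1 $ k $ m - ?W s $ k $ m)) \<longlongrightarrow> det M) (at 0)"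
    unfolding M_def
  proof (rule tendsto_det)
    fix k m :: "'e bond"
    have "((\<lambda>s. cis (s * l $ fst k)) \<longlongrightarrow> cis (0 * l $ fst k)) (at 0)"
      by (intro tendsto_intros)
    then have "((\<lambda>s. mat 1 $ k $ m - ?W s $ k $ m) \<longlongrightarrow> mat 1 $ k $ m - ?U $ k $ m) (at 0)"
      unfolding W by (auto intro!: tendsto_eq_intros)
    moreover have "((\<lambda>s. (\<chi> b. r s b * a $ b) $ k) \<longlongrightarrow> - \<i> * of_real (l $ fst k) * a $ k) (at 0)"
      using tendsto_mult[OF r[of k] tendsto_const[of "a $ k"]] by simp
    ultimately show "((\<lambda>s. if m = i then (\<chi> b. r s b * a $ b) $ k else mat 1 $ k $ m - ?W s $ k $ m) \<longlongrightarrow>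
        (if m = i then - \<i> * of_real (l $ fst k) * a $ k else mat 1 $ k $ m - ?U $ k $ m)) (at 0)"
      by simp
  qed
  then have "((\<lambda>s. det (mat 1 - ?W s) / of_real s) \<longlongrightarrow> det M / a $ i) (at 0)"
    using i by (intro Lim_transform_eventually[OF _ ev] tendsto_intros) auto
  moreover have "det M \<noteq> 0"
  proof
    assume "det M = 0"
    then obtain x where x: "x \<noteq> 0" "M *v x = 0" using det_eq_0_iff_kernel by blast
    have Mx: "(M *v x) $ k = x $ i * (- \<i> * of_real (l $ fst k) * a $ k)
        + (\<Sum>m\<in>UNIV - {i}. x $ m * (mat 1 $ k $ m - ?U $ k $ m))" for k :: "'e bond"
      by (simp add: matrix_vector_mult_def M_def sum.remove[of UNIV i] mult_ac)
    have left: "(\<Sum>k\<in>(UNIV :: 'e bond set). cnj (a $ k) * (mat 1 $ k $ m - ?U $ k $ m)) = 0"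
      for m :: "'e bond"
      using U_B_fixed_left[OF \<theta> a(1), of m]
      by (simp add: right_diff_distrib sum_subtractf mat_def if_distrib[of "\<lambda>y. _ * y"] sum.delta cong: if_cong)
    \<comment> \<open>Pairing with \<open>a\<close> annihilates every column but the replaced one,
      so the product of \<open>x $ i\<close> and the weighted norm of \<open>a\<close> is 0.\<close>
    have "0 = (\<Sum>k\<in>UNIV. cnj (a $ k) * (M *v x) $ k)" by (simp add: x(2))
    also have "\<dots> = x $ i * (- \<i> * (\<Sum>k\<in>UNIV. of_real (l $ fst k) * (a $ k * cnj (a $ k))))
        + (\<Sum>k\<in>UNIV. \<Sum>m\<in>UNIV - {i}. x $ m * (cnj (a $ k) * (mat 1 $ k $ m - ?U $ k $ m)))"
      unfolding Mx distrib_left sum.distrib sum_distrib_left by (simp add: mult_ac)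
    also have "(\<Sum>k\<in>UNIV. \<Sum>m\<in>UNIV - {i}. x $ m * (cnj (a $ k) * (mat 1 $ k $ m - ?U $ k $ m))) = 0"
      by (subst sum.swap) (simp only: sum_distrib_left[symmetric] left, simp)
    also have "(\<Sum>k\<in>UNIV. of_real (l $ fst k) * (a $ k * cnj (a $ k))) =
        complex_of_real (\<Sum>k\<in>UNIV. l $ fst k * (cmod (a $ k))\<^sup>2)"
      by (simp only: complex_norm_square of_real_sum of_real_mult)
    finally have "x $ i = 0 \<or> (\<Sum>k\<in>UNIV. l $ fst k * (cmod (a $ k))\<^sup>2) = 0"
      by (simp only: add_0_right mult_eq_0_iff eq_commute[of 0] neg_equal_0_iff_equal of_real_eq_0_iff) auto
    moreover have "0 < (\<Sum>k\<in>UNIV. l $ fst k * (cmod (a $ k))\<^sup>2)"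
      using l i by (intro sum_pos2[of UNIV i]) (auto simp: less_imp_le)
    ultimately have xi: "x $ i = 0" by auto
    \<comment> \<open>With \<open>x $ i = 0\<close> the replaced column drops out, and
      \<open>M *v x = 0\<close> says that \<open>x\<close> is fixed by U.\<close>
    have "(?U *v x) $ k = x $ k" for k
    proof -
      have "0 = (\<Sum>m\<in>UNIV. x $ m * (mat 1 $ k $ m - ?U $ k $ m))"
        using Mx[of k] by (simp add: x(2) xi sum.remove[of UNIV i])
      also have "\<dots> = x $ k - (?U *v x) $ k"
        by (simp add: right_diff_distrib sum_subtractf mat_def if_distrib[of "\<lambda>y. _ * y"] sum.delta
          matrix_vector_mult_def mult.commute cong: if_cong)
      finally show ?thesis by simp
    qed
    then have "?U *v x = x" by (simp add: vec_eq_iff)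
    from geometric_multiplicity_simple_eigenvalue[OF simple a(1) i this xi] x(1)
    show False by simp
  qed
  ultimately show ?thesis using i by (intro exI[of _ "det M / a $ i"]) auto
qed

text \<open>A derivative at a single point suffices: only a sign change of \<open>h\<close> along \<open>l\<close> is needed.\<close>

lemma zero_along_transversal_pos:
  fixes h :: "'a::real_normed_vector \<Rightarrow> real"
  assumes h: "(h has_derivative h') (at 0)" and h0: "h 0 = 0" and pos: "0 < h' l"
    and cont: "continuous_on UNIV h"
  shows "\<exists>\<delta>>0. \<exists>C>0. \<forall>v. norm v < \<delta> \<longrightarrow> (\<exists>s. \<bar>s\<bar> \<le> C * norm v \<and> h (v + s *\<^sub>R l) = 0)"
proof -
  interpret h': bounded_linear h' using h by (rule has_derivative_bounded_linear)
  obtain b where b: "0 \<le> b" "\<And>v. norm (h' v) \<le> norm v * b" using h'.nonneg_bounded by blast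
  \<comment> \<open>At |s| = C |v| the term s h'(l) has size 2 (b + 1) |v|, which dominates both
    |h'(v)| \<le> b |v| and a linearisation error |v|.\<close>
  define C where "C = 2 * (b + 1) / h' l"
  have C: "0 < C" "C * h' l = 2 * (b + 1)" using pos b(1) by (auto simp: C_def)
  \<comment> \<open>For |s| = C |v| the vector v + s l has norm at most M |v|, so the tolerance 1 /
    M yields an error of at most |v|.\<close>
  define M where "M = 1 + C * norm l"
  have M: "1 \<le> M" using C(1) by (simp add: M_def)
  obtain d where d: "0 < d" "\<And>y. norm y < d \<Longrightarrow> norm (h y - h' y) \<le> 1 / M * norm y"
  proof -
    have "0 < 1 / M" using M by simp
    with h have "\<exists>d>0. \<forall>y. norm (y - 0) < d \<longrightarrow> norm (h y - h 0 - h' (y - 0)) \<le> 1 / M * norm (y - 0)"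
      unfolding has_derivative_at_alt by blast
    with that h0 show ?thesis by auto
  qed
  have sign: "\<exists>s. \<bar>s\<bar> \<le> C * norm v \<and> h (v + s *\<^sub>R l) = 0" if v: "norm v < d / M" for v
  proof (cases "v = 0")
    case True
    then show ?thesis using h0 by (intro exI[of _ 0]) auto
  next
    case False
    then have nv: "0 < norm v" by simp
    let ?s = "C * norm v"
    have err: "\<bar>h (v + s *\<^sub>R l) - (h' v + s * h' l)\<bar> \<le> norm v" if s: "\<bar>s\<bar> = ?s" for s
    proof -
      have le: "norm (v + s *\<^sub>R l) \<le> norm v * M"
        using norm_triangle_ineq[of v "s *\<^sub>R l"] s by (simp add: M_def algebra_simps)
      also have "\<dots> < d" using v M by (simp add: field_simps)
      finally have "norm (h (v + s *\<^sub>R l) - h' (v + s *\<^sub>R l)) \<le> 1 / M * norm (v + s *\<^sub>R l)" by (rule d(2))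
      also have "\<dots> \<le> 1 / M * (norm v * M)" using le M by (intro mult_left_mono) auto
      finally show ?thesis using M by (simp add: h'.add h'.scaleR)
    qed
    have sh: "?s * h' l = 2 * (b + 1) * norm v" using C(2) by (metis mult.assoc mult.commute)
    have hb: "\<bar>h' v\<bar> \<le> norm v * b" using b(2)[of v] by simp
    have s0: "0 \<le> ?s" using C(1) by simp
    have "0 \<le> norm v * b" using b(1) by simp
    then have "0 \<le> h (v + ?s *\<^sub>R l)" "h (v + (- ?s) *\<^sub>R l) \<le> 0"
      using err[of ?s] err[of "- ?s"] sh hb nv s0 by (auto simp: algebra_simps abs_le_iff)
    moreover have "continuous_on {- ?s..?s} (\<lambda>s. h (v + s *\<^sub>R l))"
      by (intro continuous_on_compose2[OF cont] continuous_intros) auto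
    ultimately obtain s where "- ?s \<le> s" "s \<le> ?s" "h (v + s *\<^sub>R l) = 0"
      using s0 IVT'[of "\<lambda>s. h (v + s *\<^sub>R l)" "- ?s" 0 ?s] by auto
    then show ?thesis by (intro exI[of _ s]) auto
  qed
  show ?thesis
    using sign d(1) M C(1) by (intro exI[of _ "d / M"] conjI exI[of _ C]) auto
qed

lemma zero_along_transversal:
  fixes h :: "'a::real_normed_vector \<Rightarrow> real"
  assumes h: "(h has_derivative h') (at 0)" and h0: "h 0 = 0" and nz: "h' l \<noteq> 0"
    and cont: "continuous_on UNIV h"
  shows "\<exists>\<delta>>0. \<exists>C>0. \<forall>v. norm v < \<delta> \<longrightarrow> (\<exists>s. \<bar>s\<bar> \<le> C * norm v \<and> h (v + s *\<^sub>R l) = 0)"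
proof (cases "0 < h' l")
  case True
  with assms show ?thesis by (intro zero_along_transversal_pos)
next
  case False
  have "((\<lambda>x. - h x) has_derivative (\<lambda>x. - h' x)) (at 0)" using h by (rule has_derivative_minus)
  from zero_along_transversal_pos[OF this, of l] False nz h0 cont show ?thesis
    by (auto intro: continuous_on_minus)
qed

text \<open>Each edge carries two bonds, so translation by \<open>v\<close> multiplies det U by exp
  (2 i sum v_e). Half of this phase, undone by \<open>\<kappa>\<close>, and the square root
  \<open>\<omega>\<close> of the conjugate determinant at \<theta> make the secular determinant
  real. Its zeros are then found by a sign change along the flow.\<close>

lemma secular_zero_near:
  fixes G :: "('v, 'e::finite) multigraph"
  assumes \<theta>: "\<theta> \<in> torus" and simple: "simple_eigenvalue (U_B G bc \<theta>) 1"
    and a: "U_B G bc \<theta> *v a = a" "a \<noteq> 0" and l: "\<forall>e. 0 < l $ e"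
  shows "\<exists>\<delta>>0. \<exists>C>0. \<forall>v. norm v < \<delta> \<longrightarrow>
    (\<exists>s. \<bar>s\<bar> \<le> C * norm v \<and> \<theta> * tclass (v + s *\<^sub>R l) \<in> Z_B G bc)"
proof -
  define F where "F v = det (mat 1 - U_B G bc (\<theta> * tclass v))" for v
  define \<kappa> where "\<kappa> v = cis (- (\<Sum>e\<in>UNIV. v $ e))" for v :: "real ^ 'e"
  define \<mu> where "\<mu> = cnj (det (U_B G bc \<theta>))"
  have "det (U_B G bc \<theta>) * cnj (det (U_B G bc \<theta>)) = 1"
    using arg_cong[OF U_B_unitary[OF \<theta>, of G bc], of det] by (simp add: det_mul det_adj)
  then have "complex_of_real ((cmod \<mu>)\<^sup>2) = of_real 1"
    by (simp only: complex_norm_square \<mu>_def complex_cnj_cnj mult.commute of_real_1)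
  then have \<mu>: "cmod \<mu> = 1"
    using power2_eq_1_iff[of "cmod \<mu>"] norm_ge_zero[of \<mu>] by (simp only: of_real_eq_iff) linarith
  define \<omega> where "\<omega> = csqrt \<mu>"
  have \<omega>: "cnj \<omega> * \<mu> = \<omega>" "\<omega> \<noteq> 0"
  proof -
    have 1: "\<omega> * \<omega> = \<mu>" by (simp add: \<omega>_def power2_eq_square[symmetric])
    then show "\<omega> \<noteq> 0" using \<mu> by auto
    have "cmod \<omega> * cmod \<omega> = 1" using \<mu> 1 by (metis norm_mult)
    then have "\<omega> * cnj \<omega> = 1"
      by (metis complex_norm_square of_real_1 power2_eq_square)
    then show "cnj \<omega> * \<mu> = \<omega>" unfolding 1[symmetric] by (metis mult.assoc mult.commute mult_1)
  qed
  have detU: "det (U_B G bc (\<theta> * tclass v)) = cis (2 * (\<Sum>e\<in>UNIV. v $ e)) * det (U_B G bc \<theta>)" for v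
  proof -
    have "(\<Prod>e\<in>UNIV. (cis (v $ e))\<^sup>2) = cis (2 * (\<Sum>e\<in>UNIV. v $ e))"
      unfolding Complex.DeMoivre by (simp add: sum_distrib_left cis_conv_exp exp_sum)
    then show ?thesis
      by (simp add: U_B_def det_mul det_D_B tclass_def power_mult_distrib prod.distrib)
  qed
  have real: "\<omega> * \<kappa> v * F v \<in> \<real>" for v
  proof -
    have "cnj (F v) = cnj (det (U_B G bc (\<theta> * tclass v))) * F v"
      unfolding F_def using \<theta> by (intro cnj_secular torus_mult) auto
    also have "cnj (det (U_B G bc (\<theta> * tclass v))) = \<kappa> v * \<kappa> v * \<mu>"
      by (simp add: detU \<kappa>_def \<mu>_def cis_cnj cis_mult)
    finally have "cnj (\<omega> * \<kappa> v * F v) = (cnj \<omega> * \<mu>) * (cnj (\<kappa> v) * \<kappa> v) * \<kappa> v * F v"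
      by (simp add: mult_ac)
    also have "cnj (\<kappa> v) * \<kappa> v = 1" by (simp add: \<kappa>_def cis_cnj cis_mult)
    finally show ?thesis by (simp add: \<omega>(1) Reals_cnj_iff)
  qed
  define h where "h v = Re (\<omega> * \<kappa> v * F v)" for v
  have h: "of_real (h v) = \<omega> * \<kappa> v * F v" for v
    unfolding h_def by (rule of_real_Re[OF real])
  have \<kappa>0: "\<kappa> v \<noteq> 0" for v by (simp add: \<kappa>_def)
  have h0: "h v = 0 \<longleftrightarrow> F v = 0" for v
    using h[of v] \<omega>(2) \<kappa>0[of v] by (metis mult_eq_0_iff of_real_eq_0_iff)
  have diff: "h differentiable (at x)" for x
  proof -
    from secular_differentiable[of G bc \<theta> x] obtain F' where F': "(F has_derivative F') (at x)"
      unfolding F_def differentiable_def by blast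
    have "\<exists>D. ((\<lambda>v. \<kappa> v) has_derivative D) (at x)"
      unfolding \<kappa>_def
      by (rule exI, (rule has_derivative_cis_compose derivative_eq_intros refl bounded_linear.has_derivative[OF bounded_linear_vec_nth])+)
    then obtain D where D: "(\<kappa> has_derivative D) (at x)" by blast
    have "((\<lambda>v. \<omega> * \<kappa> v * F v) has_derivative (\<lambda>y. \<omega> * \<kappa> x * F' y + \<omega> * D y * F x)) (at x)"
      using D F' by (auto intro!: derivative_eq_intros)
    then show ?thesis
      unfolding h_def differentiable_def using bounded_linear.has_derivative[OF bounded_linear_Re] by blast
  qed
  obtain c where c: "c \<noteq> 0" "((\<lambda>s. F (s *\<^sub>R l) / of_real s) \<longlongrightarrow> c) (at 0)"
    using secular_derivative_along_flow[OF assms] unfolding F_def by blast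
  have F0: "F 0 = 0"
    unfolding F_def det_eq_0_iff_kernel using a
    by (intro exI[of _ a]) (simp add: matrix_vector_mult_diff_rdistrib)
  obtain h' where h': "(h has_derivative h') (at 0)" using diff[of 0] unfolding differentiable_def by blast
  \<comment> \<open>The factor between \<open>h\<close> and \<open>F\<close> is continuous along the
    flow and never zero, so the quotient h (s l) / s inherits a nonzero limit from
    \<open>F\<close>.\<close>
  have "h' l \<noteq> 0"
  proof
    assume 0: "h' l = 0"
    interpret h': bounded_linear h' using h' by (rule has_derivative_bounded_linear)
    have "((\<lambda>s. h (s *\<^sub>R l)) has_derivative (\<lambda>s. h' (s *\<^sub>R l))) (at 0)"
      by (rule has_derivative_compose[of "\<lambda>s. s *\<^sub>R l"]) (auto intro!: derivative_eq_intros h')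
    then have "((\<lambda>s. h (s *\<^sub>R l)) has_real_derivative 0) (at 0)"
      by (simp add: has_field_derivative_def h'.scaleR 0 lambda_zero)
    then have "((\<lambda>s. h (s *\<^sub>R l) / s) \<longlongrightarrow> 0) (at 0)"
      using h0[of 0] F0 by (simp add: DERIV_def)
    then have "((\<lambda>s. complex_of_real (h (s *\<^sub>R l) / s)) \<longlongrightarrow> of_real 0) (at 0)"
      by (rule tendsto_of_real)
    moreover have "((\<lambda>s. \<omega> * \<kappa> (s *\<^sub>R l) * (F (s *\<^sub>R l) / of_real s)) \<longlongrightarrow> \<omega> * \<kappa> (0 *\<^sub>R l) * c) (at 0)"
      unfolding \<kappa>_def vector_scaleR_component by (intro tendsto_intros c)
    ultimately have "\<omega> * \<kappa> (0 *\<^sub>R l) * c = of_real 0"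
      by (intro tendsto_unique[OF trivial_limit_at]) (simp_all add: h)
    then show False using \<omega>(2) c(1) \<kappa>0[of "0 *\<^sub>R l"] by (simp del: scaleR_zero_left)
  qed
  moreover have "continuous_on UNIV h"
    using diff by (intro differentiable_imp_continuous_on) (simp add: differentiable_on_def)
  ultimately obtain \<delta> C where "0 < \<delta>" "0 < C"
    and z: "\<And>v. norm v < \<delta> \<Longrightarrow> \<exists>s. \<bar>s\<bar> \<le> C * norm v \<and> h (v + s *\<^sub>R l) = 0"
    using zero_along_transversal[OF h', of l] h0[of 0] F0 by blast
  moreover have "\<theta> * tclass v \<in> Z_B G bc \<longleftrightarrow> h v = 0" for v
    using \<theta> by (simp add: h0 Z_B_def F_def torus_mult)
  ultimately show ?thesis by metis
qed

section \<open>Crossing times\<close>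

lemma pos_def_form_bound:
  assumes "pos_def_form B"
  shows "\<exists>b>0. \<forall>v. sqrt (B v v) \<le> b * norm v"
proof -
  have "bilinear B" using assms by (simp add: pos_def_form_def)
  then obtain b where b: "0 < b" "\<And>x y. norm (B x y) \<le> b * norm x * norm y"
    using bilinear_bounded_pos by blast
  have "sqrt (B v v) \<le> sqrt b * norm v" for v
  proof -
    have "B v v \<le> b * (norm v)\<^sup>2" using b(2)[of v v] by (simp add: power2_eq_square)
    then have "sqrt (B v v) \<le> sqrt (b * (norm v)\<^sup>2)" by (rule real_sqrt_le_mono)
    then show ?thesis by (simp add: real_sqrt_mult)
  qed
  then show ?thesis using b(1) by (intro exI[of _ "sqrt b"]) auto
qed

lemma flat_dist_le:
  assumes "pos_def_form B" "v \<in> torus_lie_algebra H" "x * tclass v = y"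
  shows "flat_dist B H x y \<le> sqrt (B v v)"
proof -
  have "0 \<le> B v v" for v
    using assms(1) by (cases "v = 0") (auto simp: pos_def_form_def bilinear_lzero less_imp_le)
  then show ?thesis
    unfolding flat_dist_def using assms(2,3) by (intro cInf_lower bdd_belowI[of _ 0]) auto
qed

text \<open>The hitting time is corrected by a time \<open>s\<close> of order 1/m to reach the
  secular set. Displacements are kept in the form \<open>M *v x\<close> with intrinsic coordinates
  \<open>x\<close>: such vectors lie in the Lie algebra of the closure and thus bound its
  distance.\<close>

lemma near_crossing_times:
  fixes G :: "('v, 'e::finite) multigraph" and \<Xi> :: "complex ^ 'r \<Rightarrow> complex ^ 'e"
  assumes l: "\<forall>e. 0 < l $ e" and \<theta>: "\<theta> \<in> orbit_closure l" "\<theta> \<in> R_set G bc K"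
    and B: "pos_def_form B" and iso: "torus_lie_iso \<Xi> (orbit_closure l)"
    and flow: "\<And>t. \<Xi> (tclass (t *\<^sub>R \<beta>)) = tclass (t *\<^sub>R l)"
    and \<gamma>: "0 < \<gamma>" and \<tau>: "1 \<le> \<tau>" and dio: "diophantine \<beta> \<gamma> \<tau>"
  shows "\<exists>C>0. \<exists>k :: nat \<Rightarrow> real. filterlim k at_top sequentially \<and>
    (\<forall>n. k n > 0 \<and> tclass (k n *\<^sub>R l) \<in> Z_B G bc \<and>
      flat_dist B (orbit_closure l) (tclass (k n *\<^sub>R l)) \<theta> \<le> C * k n powr (- 1 / \<tau>))"
proof -
  let ?H = "orbit_closure l"
  from \<theta>(2) obtain a where a: "a \<noteq> 0" "U_B G bc \<theta> *v a = a"
    and simple: "simple_eigenvalue (U_B G bc \<theta>) 1" and \<theta>T: "\<theta> \<in> torus"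
    unfolding R_set_def Z_B_def by blast
  from secular_zero_near[OF \<theta>T simple a(2,1) l] obtain \<delta> S where \<delta>: "0 < \<delta>" and S: "0 < S"
    and zero: "\<And>v. norm v < \<delta> \<Longrightarrow> \<exists>s. \<bar>s\<bar> \<le> S * norm v \<and> \<theta> * tclass (v + s *\<^sub>R l) \<in> Z_B G bc" by blast
  from iso obtain N :: "int ^ 'r ^ 'e" where bij: "bij_betw \<Xi> torus ?H"
    and N: "\<And>x. \<Xi> (tclass x) = tclass (map_matrix real_of_int N *v x)"
    unfolding torus_lie_iso_def by blast
  define M where "M = map_matrix real_of_int N"
  note N = N[folded M_def]
  obtain y where y: "\<theta> = \<Xi> (tclass y)"
    using bij \<theta>(1) unfolding bij_betw_def torus_eq_range_tclass by blast
  obtain \<kappa> where \<kappa>: "0 < \<kappa>" "\<And>x. norm (M *v x) \<le> \<kappa> * norm x"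
    using linear_bounded_pos[OF matrix_vector_mul_linear[of M]] by blast
  obtain b where b: "0 < b" "\<And>v. sqrt (B v v) \<le> b * norm v" using pos_def_form_bound[OF B] by blast
  from diophantine_orbit_hits[OF dio \<gamma>, of y] \<tau> obtain A D where A: "0 < A" and D: "0 < D"
    and hit: "\<And>m. D < real m \<Longrightarrow> \<exists>t w. A * real m powr \<tau> \<le> t \<and> t \<le> 2 * A * real m powr \<tau> \<and>
      tclass (t *\<^sub>R \<beta> + w) = tclass y \<and> norm w \<le> D / real m" by auto
  \<comment> \<open>Three thresholds: the hitting lemma applies, the displacement falls below
    \<delta>, and the time correction is at most A / 2.\<close>
  obtain n0 :: nat where n0: "max D (max (\<kappa> * D / \<delta>) (2 * S * \<kappa> * D / A)) < real n0"
    using reals_Archimedean2 by blast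
  define c where "c = b * (\<kappa> * (D + S * \<kappa> * D * norm \<beta>))"
  have c: "0 < c" unfolding c_def using b(1) \<kappa>(1) D S by (intro mult_pos_pos add_pos_nonneg) auto
  have lie: "M *v x \<in> torus_lie_algebra ?H" for x
  proof -
    have "tclass (u *\<^sub>R (M *v x)) = \<Xi> (tclass (u *\<^sub>R x))" for u
      by (simp add: N matrix_vector_mult_scaleR)
    then show ?thesis using bij unfolding torus_lie_algebra_def bij_betw_def by auto
  qed
  define P where "P m k \<longleftrightarrow> A / 2 * real m powr \<tau> \<le> k \<and> k \<le> 3 * A * real m powr \<tau> \<and>
    tclass (k *\<^sub>R l) \<in> Z_B G bc \<and> flat_dist B ?H (tclass (k *\<^sub>R l)) \<theta> \<le> c / real m" for m k
  have "\<exists>k. P m k" if mn: "n0 \<le> m" for m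
  proof -
    have m: "D < real m" "\<kappa> * D / \<delta> < real m" "2 * S * \<kappa> * D / A < real m" using n0 mn by auto
    have m0: "0 < real m" using m(1) D by linarith
    from hit[OF m(1)] obtain t w where t: "A * real m powr \<tau> \<le> t" "t \<le> 2 * A * real m powr \<tau>"
      and w: "tclass (t *\<^sub>R \<beta> + w) = tclass y" "norm w \<le> D / real m" by blast
    \<comment> \<open>Displacement from \<theta> to the orbit point at time
      \<open>t\<close>.\<close>
    define v where "v = - (M *v w)"
    have v: "norm v \<le> \<kappa> * D / real m"
    proof -
      have "norm v \<le> \<kappa> * norm w" unfolding v_def using \<kappa>(2)[of w] by simp
      also have "\<dots> \<le> \<kappa> * (D / real m)" using w(2) \<kappa>(1) by (intro mult_left_mono) auto
      finally show ?thesis by simp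
    qed
    also have "\<dots> < \<delta>" using m(2) m0 \<delta> by (simp add: field_simps)
    finally obtain s where s: "\<bar>s\<bar> \<le> S * norm v" "\<theta> * tclass (v + s *\<^sub>R l) \<in> Z_B G bc"
      using zero by blast
    have sm: "\<bar>s\<bar> \<le> S * \<kappa> * D / real m"
    proof -
      have "S * norm v \<le> S * (\<kappa> * D / real m)" using v S by (intro mult_left_mono) auto
      with s(1) show ?thesis by simp
    qed
    have "\<theta> = tclass (M *v (t *\<^sub>R \<beta>) + M *v w)"
      unfolding y w(1)[symmetric] N by (simp add: matrix_vector_right_distrib)
    also have "\<dots> = tclass (t *\<^sub>R l) * tclass (M *v w)" by (simp only: tclass_add N[symmetric] flow)
    finally have \<theta>eq: "\<theta> = tclass (t *\<^sub>R l + M *v w)" by (simp only: tclass_add)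
    define k where "k = t + s"
    have "\<theta> * tclass (v + s *\<^sub>R l) = tclass (k *\<^sub>R l)"
      unfolding \<theta>eq tclass_add[symmetric] by (simp add: v_def k_def algebra_simps)
    then have kZ: "tclass (k *\<^sub>R l) \<in> Z_B G bc" using s(2) by simp
    \<comment> \<open>Displacement from the crossing point to \<theta> in intrinsic coordinates.
      Undoing the time correction along \<beta> instead of \<open>l\<close> keeps it in the form
      accepted by \<open>lie\<close>.\<close>
    define x where "x = w - s *\<^sub>R \<beta>"
    have "tclass (k *\<^sub>R l) * tclass (M *v x) = tclass (M *v (k *\<^sub>R \<beta> + x))"
      by (simp add: flow[symmetric] N tclass_add matrix_vector_right_distrib)
    also have "k *\<^sub>R \<beta> + x = t *\<^sub>R \<beta> + w" by (simp add: k_def x_def algebra_simps)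
    finally have "tclass (k *\<^sub>R l) * tclass (M *v x) = \<theta>" unfolding y w(1)[symmetric] N .
    from flat_dist_le[OF B lie this] have "flat_dist B ?H (tclass (k *\<^sub>R l)) \<theta> \<le> b * norm (M *v x)"
      using b(2) by (rule order_trans)
    also have "\<dots> \<le> b * (\<kappa> * norm x)" using \<kappa>(2)[of x] b(1) by (intro mult_left_mono) auto
    also have "\<dots> \<le> b * (\<kappa> * (D / real m + S * \<kappa> * D / real m * norm \<beta>))"
    proof (intro mult_left_mono)
      have "norm x \<le> norm w + \<bar>s\<bar> * norm \<beta>"
        unfolding x_def by (rule order_trans[OF norm_triangle_ineq4]) simp
      also have "\<dots> \<le> D / real m + S * \<kappa> * D / real m * norm \<beta>"
        by (intro add_mono w(2) mult_right_mono sm) auto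
      finally show "norm x \<le> D / real m + S * \<kappa> * D / real m * norm \<beta>" .
    qed (use b(1) \<kappa>(1) in auto)
    also have "\<dots> = c / real m" using m0 by (simp add: c_def field_simps)
    finally have dist: "flat_dist B ?H (tclass (k *\<^sub>R l)) \<theta> \<le> c / real m" .
    have "1 \<le> real m powr \<tau>" using m0 \<tau> by (intro ge_one_powr_ge_zero) auto
    then have "A / 2 * 1 \<le> A / 2 * real m powr \<tau>" using A by (intro mult_left_mono) auto
    moreover have "S * \<kappa> * D / real m \<le> A / 2" using m(3) m0 A by (simp add: field_simps)
    ultimately have "\<bar>s\<bar> \<le> A / 2 * real m powr \<tau>" using sm by linarith
    then have "A / 2 * real m powr \<tau> \<le> k" "k \<le> 3 * A * real m powr \<tau>"
      using t unfolding k_def by linarith+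
    with kZ dist show ?thesis unfolding P_def by blast
  qed
  then have "\<forall>n. \<exists>k. P (n + n0) k" by simp
  then obtain k where "\<And>n. P (n + n0) (k n)" by metis
  then have k: "A / 2 * real (n + n0) powr \<tau> \<le> k n" "k n \<le> 3 * A * real (n + n0) powr \<tau>"
      "tclass (k n *\<^sub>R l) \<in> Z_B G bc" "flat_dist B ?H (tclass (k n *\<^sub>R l)) \<theta> \<le> c / real (n + n0)" for n
    unfolding P_def by blast+
  have n0pos: "0 < real n0" using n0 D by linarith
  \<comment> \<open>As \<tau> \<ge> 1, the lower end of the window grows at least linearly, which
    forces divergence of the times.\<close>
  have kge: "A / 2 * real (n + n0) \<le> k n" for n
  proof -
    have "1 \<le> real (n + n0)" using n0pos by simp
    then have "real (n + n0) powr 1 \<le> real (n + n0) powr \<tau>" using \<tau> by (intro powr_mono) auto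
    then have "A / 2 * real (n + n0) \<le> A / 2 * real (n + n0) powr \<tau>" using A n0pos by simp
    with k(1) show ?thesis by (rule order_trans[rotated])
  qed
  have kpos: "0 < k n" for n
  proof -
    have "0 < A / 2 * real (n + n0)" using A n0pos by simp
    with kge[of n] show ?thesis by linarith
  qed
  have "filterlim (\<lambda>n. A / 2 * real (n + n0)) at_top sequentially"
    using A by (intro filterlim_tendsto_pos_mult_at_top[OF tendsto_const]
      filterlim_compose[OF filterlim_real_sequentially] filterlim_add_const_nat_at_top) auto
  then have "filterlim k at_top sequentially"
    by (rule filterlim_at_top_mono) (rule always_eventually, rule allI, rule kge)
  moreover have "flat_dist B ?H (tclass (k n *\<^sub>R l)) \<theta> \<le> c * (3 * A) powr (1 / \<tau>) * k n powr (- 1 / \<tau>)" for n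
  proof -
    define m where "m = real (n + n0)"
    have m: "0 < m" using n0pos by (simp add: m_def)
    \<comment> \<open>The upper end of the window, solved for 1 / m, converts the bound c / m into a
      power of the crossing time.\<close>
    have "k n powr (1 / \<tau>) \<le> (3 * A * m powr \<tau>) powr (1 / \<tau>)"
      using k(2)[of n] kpos[of n] \<tau> by (intro powr_mono2) (auto simp: m_def)
    also have "\<dots> = (3 * A) powr (1 / \<tau>) * m" using A m \<tau> by (simp add: powr_mult powr_powr)
    finally have "1 / m \<le> (3 * A) powr (1 / \<tau>) * k n powr (- 1 / \<tau>)"
      using m kpos[of n] by (simp add: powr_minus_divide field_simps)
    then have "c * (1 / m) \<le> c * ((3 * A) powr (1 / \<tau>) * k n powr (- 1 / \<tau>))"
      using c by (intro mult_left_mono) auto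
    with k(4)[of n] show ?thesis by (simp add: m_def mult.assoc)
  qed
  moreover have "0 < c * (3 * A) powr (1 / \<tau>)" using c A by simp
  ultimately show ?thesis using k(3) kpos by blast
qed

text \<open>The type \<open>'r\<close> indexes intrinsic coordinates, so its size must be the
  dimension of the closure. \<open>B\<close> induces the flat metric, and positivity of
  \<open>k n\<close> ensures that \<open>powr\<close> is the usual real power.\<close>

theorem theorem6p2:
  fixes G :: "('v::finite, 'e::finite) multigraph"
    and bc :: "'v \<Rightarrow> boundary_cond"
    and l :: "real ^ 'e"
    and K :: "'e set"
    and \<theta>star :: "complex ^ 'e"
    and B :: "real ^ 'e \<Rightarrow> real ^ 'e \<Rightarrow> real"
  assumes "connected_graph G"
    and "\<forall>e. 0 < l $ e"
    and "proper_primitive_subgraph G K"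
    and "\<theta>star \<in> orbit_closure l \<inter> R_set G bc K"
    and "pos_def_form B"
  shows
    "(\<forall>(\<Xi> :: complex ^ 'r \<Rightarrow> complex ^ 'e) (\<beta> :: real ^ 'r) \<gamma> \<tau>.
        CARD('r) = torus_dim (orbit_closure l) \<and> torus_dim (orbit_closure l) \<ge> 2 \<and>
        torus_lie_iso \<Xi> (orbit_closure l) \<and>
        (\<forall>t::real. \<Xi> (tclass (t *\<^sub>R \<beta>)) = tclass (t *\<^sub>R l)) \<and>
        \<gamma> > 0 \<and> \<tau> > real (torus_dim (orbit_closure l)) - 1 \<and> diophantine \<beta> \<gamma> \<tau>
      \<longrightarrow> (\<exists>C>0. \<exists>k :: nat \<Rightarrow> real. filterlim k at_top sequentially \<and>
            (\<forall>n. k n > 0 \<and> tclass (k n *\<^sub>R l) \<in> Z_B G bc \<and>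
              flat_dist B (orbit_closure l) (tclass (k n *\<^sub>R l)) \<theta>star \<le> C * k n powr (- 1 / \<tau>))))
     \<and>
     (torus_dim (orbit_closure l) = 1 \<longrightarrow>
        (\<exists>T>0. \<forall>\<theta> \<in> orbit_closure l. \<forall>t::real.
            \<theta> * tclass ((t + T) *\<^sub>R l) = \<theta> * tclass (t *\<^sub>R l)) \<and>
        (\<exists>k :: nat \<Rightarrow> real. filterlim k at_top sequentially \<and>
            (\<forall>n. tclass (k n *\<^sub>R l) = \<theta>star)))"
proof (intro conjI allI impI)
  fix \<Xi> :: "complex ^ 'r \<Rightarrow> complex ^ 'e" and \<beta> :: "real ^ 'r" and \<gamma> \<tau> :: real
  assume "CARD('r) = torus_dim (orbit_closure l) \<and> torus_dim (orbit_closure l) \<ge> 2 \<and>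
    torus_lie_iso \<Xi> (orbit_closure l) \<and>
    (\<forall>t::real. \<Xi> (tclass (t *\<^sub>R \<beta>)) = tclass (t *\<^sub>R l)) \<and>
    \<gamma> > 0 \<and> \<tau> > real (torus_dim (orbit_closure l)) - 1 \<and> diophantine \<beta> \<gamma> \<tau>"
  with assms show "\<exists>C>0. \<exists>k :: nat \<Rightarrow> real. filterlim k at_top sequentially \<and>
      (\<forall>n. k n > 0 \<and> tclass (k n *\<^sub>R l) \<in> Z_B G bc \<and>
        flat_dist B (orbit_closure l) (tclass (k n *\<^sub>R l)) \<theta>star \<le> C * k n powr (- 1 / \<tau>))"
    \<comment> \<open>Dimension at least 2 and \<tau> above the dimension minus 1 give the required
      1 \<le> \<tau>.\<close>
    by (intro near_crossing_times[of l \<theta>star G bc K B \<Xi> \<beta> \<gamma>]) auto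
next
  assume dim: "torus_dim (orbit_closure l) = 1"
  have "l \<noteq> 0" using assms(2) by (metis less_irrefl zero_index)
  from flow_periodic_if_dim_1[OF dim this] obtain T where T: "0 < T" "tclass (T *\<^sub>R l) = 1" by blast
  note periodic = periodic_orbit_closure[OF T]
  have "tclass ((t + T) *\<^sub>R l) = tclass (t *\<^sub>R l)" for t using periodic(2)[of t 1] by simp
  with T(1) show "\<exists>T>0. \<forall>\<theta> \<in> orbit_closure l. \<forall>t::real.
      \<theta> * tclass ((t + T) *\<^sub>R l) = \<theta> * tclass (t *\<^sub>R l)" by auto
  \<comment> \<open>The closed orbit is its own closure, so it passes through the target exactly,
    and again after every period.\<close>
  obtain t where t: "\<theta>star = tclass (t *\<^sub>R l)" using assms(4) periodic(1) by blast
  have "filterlim (\<lambda>n. t + real n * T) at_top sequentially"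
    using T(1) by (intro filterlim_tendsto_add_at_top[OF tendsto_const]
      filterlim_at_top_mult_tendsto_pos[OF tendsto_const] filterlim_real_sequentially)
  moreover have "tclass ((t + real n * T) *\<^sub>R l) = \<theta>star" for n
    using periodic(2)[of t "int n"] t by simp
  ultimately show "\<exists>k :: nat \<Rightarrow> real. filterlim k at_top sequentially \<and>
      (\<forall>n. tclass (k n *\<^sub>R l) = \<theta>star)" by blast
qed

end
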